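(* Let $\Gamma=\{\Lambda_1,\cdots,\Lambda_n\}\subseteq S_c[X]$, $\Lambda_i=\overline{(\alpha_i,N_i)},\ \alpha_i\in S_c[X_{N_i}]$, $\Lambda=\overline{(\beta,N)},\ \beta\in S_c[X_N]$. Then $\Gamma\vdash\Lambda$ iff $\bigcap\limits_{i=1}^n A_{\alpha_i}^{(M)}\subseteq A_{\beta}^{(M)}$ for some big enough $M\in \mathbb{N}$, iff $\bigcap\limits_{i=1}^nA_{\alpha_i}\subseteq A_{\beta}$.
   Context: An idempotent complement (I-C) semiring is a commutative semiring $(S,\circ,\cdot,\theta,1)$ in which every $s$ has a complement $s^c$ with $s\cdot s^c=\theta$, $s\circ s^c=1$, $s\cdot s=s$, $s\circ s=s$. Let $X=\{x_1,x_2,\cdots\}$ be a countable set (atoms of propositional logic), $X_N=\{x_1,\dots,x_N\}$, and $S_c[X_N]$ the free I-C semiring generated by $X_N$; every element of $S_c[X_N]$ has normal form $1$ or $\sum^{\circ}_{k\in D}y_k^{(N)}$ with $D\subsetneq\{0,\dots,2^N-1\}$, where for $k=\sum_{l=1}^N j_l2^{l-1}$ ($j_l\in\{0,1\}$), $y_k^{(N)}=x_1^{j_1}\cdots x_N^{j_N}$ with $x_i^1=x_i$, $x_i^0=x_i^c$. $S_c[X]$ is the free I-C semiring generated by $X$, realized as the direct limit of the $S_c[X_N]$ under the natural embeddings $f_{NM}:S_c[X_N]\to S_c[X_M]$ ($N\le M$); its elements are classes $\overline{(\alpha,N)}$ with $\alpha\in S_c[X_N]$. For $\Gamma\subseteq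 S_c[X]$ and $\beta\in S_c[X]$, $\Gamma\vdash\beta$ means $\beta\equiv_\Gamma 1$, where $\equiv_\Gamma$ is the congruence on $S_c[X]$ generated by $\{(\alpha,1)\mid\alpha\in\Gamma\}$. Let $\aleph_N=\{0,1,\dots,2^N-1\}$; $A_i^{(N)}$ (resp. $A_i^{c(N)}$) is the set of $k\in\aleph_N$ whose binary digit of weight $2^{i-1}$ is $1$ (resp. $0$); $A_i$ (resp. $A_i^c$) is the set of all $k\in\mathbb{N}$ whose binary digit of weight $2^{i-1}$ is $1$ (resp. $0$). For $\alpha=U_1\circ\cdots\circ U_m\in S_c[X_N]$ with $U_i=x_1^{i_1}\cdots x_N^{i_N}$, where $x_l^h$ denotes $1,x_l,x_l^c$ for $h=0,1,c$, set $A_\alpha^{(N)}=\bigcup_{i=1}^m\bigcap_{j=1}^N A_j^{i_j(N)}$ with $A_j^{i_j(N)}=\aleph_N,A_j^{(N)},A_j^{c(N)}$ for $i_j=0,1,c$, and $A_\alpha=\bigcup_{i=1}^m\bigcap_{j=1}^N A_j^{i_j}$ with $A_j^{i_j}=\mathbb{N},A_j,A_j^c$ for $i_j=0,1,c$. *)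

theory Defs
  imports "HOL-Algebra.Ring"
begin

section \<open>Idempotent complement semirings\<close>

text \<open>
  Semirings are the ones of HOL-Algebra: \<open>\<oplus>\<close>, \<open>\<zero>\<close> are the operations
  written as a circle and theta on paper, \<open>\<otimes>\<close>, \<open>\<one>\<close> are the product and 1.
\<close>

locale ic_semiring = semiring R + comm_monoid R for R (structure) +
  assumes compl_ex: "s \<in> carrier R \<Longrightarrow> \<exists>c\<in>carrier R. s \<otimes> c = \<zero> \<and> s \<oplus> c = \<one>"
    and mult_idem: "s \<in> carrier R \<Longrightarrow> s \<otimes> s = s"
    and add_idem: "s \<in> carrier R \<Longrightarrow> s \<oplus> s = s"

definition semiring_congruence :: "('a, 'm) ring_scheme \<Rightarrow> ('a \<times> 'a) set \<Rightarrow> bool" where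
  "semiring_congruence R r \<longleftrightarrow> equiv (carrier R) r \<and>
     (\<forall>(a, b)\<in>r. \<forall>(c, d)\<in>r. (a \<oplus>\<^bsub>R\<^esub> c, b \<oplus>\<^bsub>R\<^esub> d) \<in> r \<and> (a \<otimes>\<^bsub>R\<^esub> c, b \<otimes>\<^bsub>R\<^esub> d) \<in> r)"

definition generated_congruence ::
    "('a, 'm) ring_scheme \<Rightarrow> ('a \<times> 'a) set \<Rightarrow> ('a \<times> 'a) set" where
  "generated_congruence R G = \<Inter>{r. semiring_congruence R r \<and> G \<subseteq> r}"


section \<open>The free I-C semiring on a set of atoms\<close>

text \<open>
  Terms modulo provable equality. Complements in an I-C semiring are unique, so
  complementation may be taken as an operation of the term language.
\<close>

datatype (atoms: 'a) ic_term =
    Atom 'a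
  | Zero
  | One
  | Plus "'a ic_term" "'a ic_term"
  | Times "'a ic_term" "'a ic_term"
  | Compl "'a ic_term"

definition ic_terms :: "'a set \<Rightarrow> 'a ic_term set" where
  "ic_terms V = {t. atoms t \<subseteq> V}"

inductive ic_eq :: "'a set \<Rightarrow> 'a ic_term \<Rightarrow> 'a ic_term \<Rightarrow> bool" for V where
  refl: "s \<in> ic_terms V \<Longrightarrow> ic_eq V s s"
| sym: "ic_eq V s t \<Longrightarrow> ic_eq V t s"
| trans: "ic_eq V s t \<Longrightarrow> ic_eq V t u \<Longrightarrow> ic_eq V s u"
| Plus_cong: "ic_eq V s s' \<Longrightarrow> ic_eq V t t' \<Longrightarrow> ic_eq V (Plus s t) (Plus s' t')"
| Times_cong: "ic_eq V s s' \<Longrightarrow> ic_eq V t t' \<Longrightarrow> ic_eq V (Times s t) (Times s' t')"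
| Compl_cong: "ic_eq V s s' \<Longrightarrow> ic_eq V (Compl s) (Compl s')"
| Plus_assoc: "s \<in> ic_terms V \<Longrightarrow> t \<in> ic_terms V \<Longrightarrow> u \<in> ic_terms V \<Longrightarrow>
    ic_eq V (Plus (Plus s t) u) (Plus s (Plus t u))"
| Plus_commute: "s \<in> ic_terms V \<Longrightarrow> t \<in> ic_terms V \<Longrightarrow> ic_eq V (Plus s t) (Plus t s)"
| Plus_Zero: "s \<in> ic_terms V \<Longrightarrow> ic_eq V (Plus Zero s) s"
| Times_assoc: "s \<in> ic_terms V \<Longrightarrow> t \<in> ic_terms V \<Longrightarrow> u \<in> ic_terms V \<Longrightarrow>
    ic_eq V (Times (Times s t) u) (Times s (Times t u))"
| Times_commute: "s \<in> ic_terms V \<Longrightarrow> t \<in> ic_terms V \<Longrightarrow> ic_eq V (Times s t) (Times t s)"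
| Times_One: "s \<in> ic_terms V \<Longrightarrow> ic_eq V (Times One s) s"
| distrib: "s \<in> ic_terms V \<Longrightarrow> t \<in> ic_terms V \<Longrightarrow> u \<in> ic_terms V \<Longrightarrow>
    ic_eq V (Times (Plus s t) u) (Plus (Times s u) (Times t u))"
| Times_Zero: "s \<in> ic_terms V \<Longrightarrow> ic_eq V (Times Zero s) Zero"
| Times_Compl: "s \<in> ic_terms V \<Longrightarrow> ic_eq V (Times s (Compl s)) Zero"
| Plus_Compl: "s \<in> ic_terms V \<Longrightarrow> ic_eq V (Plus s (Compl s)) One"
| Times_idem: "s \<in> ic_terms V \<Longrightarrow> ic_eq V (Times s s) s"
| Plus_idem: "s \<in> ic_terms V \<Longrightarrow> ic_eq V (Plus s s) s"

definition ic_class :: "'a set \<Rightarrow> 'a ic_term \<Rightarrow> 'a ic_term set" where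
  "ic_class V s = {t. ic_eq V s t}"

definition ic_free :: "'a set \<Rightarrow> 'a ic_term set ring" where
  "ic_free V = \<lparr>carrier = ic_class V ` ic_terms V,
     mult = (\<lambda>a b. \<Union>s\<in>a. \<Union>t\<in>b. ic_class V (Times s t)),
     one = ic_class V One,
     zero = ic_class V Zero,
     add = (\<lambda>a b. \<Union>s\<in>a. \<Union>t\<in>b. ic_class V (Plus s t))\<rparr>"


section \<open>The semirings over finitely many atoms and their direct limit\<close>

type_synonym ic_elem = "nat ic_term set"

text \<open>The atom \<open>x\<^sub>i\<close> is \<^term>\<open>Atom i\<close>, for \<^prop>\<open>1 \<le> i\<close>.\<close>

abbreviation Sc :: "nat \<Rightarrow> ic_elem ring" where
  "Sc N \<equiv> ic_free {1..N}"

text \<open>The embedding of \<^term>\<open>Sc N\<close> into \<^term>\<open>Sc M\<close> for \<^prop>\<open>N \<le> M\<close>;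
  the source index plays no role in the formula.\<close>

definition Sc_emb :: "nat \<Rightarrow> nat \<Rightarrow> ic_elem \<Rightarrow> ic_elem" where
  "Sc_emb N M \<alpha> = (\<Union>t\<in>\<alpha>. ic_class {1..M} t)"

definition Sc_rel :: "((ic_elem \<times> nat) \<times> (ic_elem \<times> nat)) set" where
  "Sc_rel = {((\<alpha>, N), (\<beta>, M)). \<alpha> \<in> carrier (Sc N) \<and> \<beta> \<in> carrier (Sc M) \<and>
     (\<exists>K. N \<le> K \<and> M \<le> K \<and> Sc_emb N K \<alpha> = Sc_emb M K \<beta>)}"

definition Sc_class :: "ic_elem \<Rightarrow> nat \<Rightarrow> (ic_elem \<times> nat) set" where
  "Sc_class \<alpha> N = Sc_rel `` {(\<alpha>, N)}"

definition Sc_lim :: "(ic_elem \<times> nat) set ring" where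
  "Sc_lim = \<lparr>carrier = {(\<alpha>, N). \<alpha> \<in> carrier (Sc N)} // Sc_rel,
     mult = (\<lambda>A B. \<Union>(\<alpha>, N)\<in>A. \<Union>(\<beta>, M)\<in>B.
       Sc_class (Sc_emb N (max N M) \<alpha> \<otimes>\<^bsub>Sc (max N M)\<^esub> Sc_emb M (max N M) \<beta>) (max N M)),
     one = Sc_class \<one>\<^bsub>Sc 0\<^esub> 0,
     zero = Sc_class \<zero>\<^bsub>Sc 0\<^esub> 0,
     add = (\<lambda>A B. \<Union>(\<alpha>, N)\<in>A. \<Union>(\<beta>, M)\<in>B.
       Sc_class (Sc_emb N (max N M) \<alpha> \<oplus>\<^bsub>Sc (max N M)\<^esub> Sc_emb M (max N M) \<beta>) (max N M))\<rparr>"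

definition entails :: "(ic_elem \<times> nat) set set \<Rightarrow> (ic_elem \<times> nat) set \<Rightarrow> bool"
    (infix \<open>\<turnstile>\<close> 50) where
  "\<Gamma> \<turnstile> \<beta> \<longleftrightarrow>
     (\<beta>, \<one>\<^bsub>Sc_lim\<^esub>) \<in> generated_congruence Sc_lim ((\<lambda>\<alpha>. (\<alpha>, \<one>\<^bsub>Sc_lim\<^esub>)) ` \<Gamma>)"


section \<open>The sets of numbers attached to elements\<close>

text \<open>The exponents \<open>0\<close>, \<open>1\<close>, \<open>c\<close> of an atom in a monomial: absent, plain,
  complemented.\<close>

datatype expo = E0 | E1 | Ec

fun atom_pow :: "nat \<Rightarrow> nat \<Rightarrow> expo \<Rightarrow> ic_elem" where
  "atom_pow N l E0 = \<one>\<^bsub>Sc N\<^esub>"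
| "atom_pow N l E1 = ic_class {1..N} (Atom l)"
| "atom_pow N l Ec = ic_class {1..N} (Compl (Atom l))"

definition monomial :: "nat \<Rightarrow> (nat \<Rightarrow> expo) \<Rightarrow> ic_elem" where
  "monomial N u = (\<Otimes>\<^bsub>Sc N\<^esub>j\<in>{1..N}. atom_pow N j (u j))"

text \<open>The element \<open>U\<^sub>1 \<oplus> \<dots> \<oplus> U\<^sub>m\<close>, where \<open>U\<^sub>i\<close> has exponents \<open>U i 1, \<dots>, U i N\<close>.
  The zero element is the empty sum, \<open>m = 0\<close>.\<close>

definition monomial_sum :: "nat \<Rightarrow> nat \<Rightarrow> (nat \<Rightarrow> nat \<Rightarrow> expo) \<Rightarrow> ic_elem" where
  "monomial_sum N m U = (\<Oplus>\<^bsub>Sc N\<^esub>i\<in>{1..m}. monomial N (U i))"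

definition aleph :: "nat \<Rightarrow> nat set" where
  "aleph N = {0..<2 ^ N}"

fun digit_set :: "nat \<Rightarrow> expo \<Rightarrow> nat set" where
  "digit_set j E0 = UNIV"
| "digit_set j E1 = {k. bit k (j - 1)}"
| "digit_set j Ec = {k. \<not> bit k (j - 1)}"

fun digit_set_fin :: "nat \<Rightarrow> nat \<Rightarrow> expo \<Rightarrow> nat set" where
  "digit_set_fin N j E0 = aleph N"
| "digit_set_fin N j E1 = {k \<in> aleph N. bit k (j - 1)}"
| "digit_set_fin N j Ec = {k \<in> aleph N. \<not> bit k (j - 1)}"

text \<open>Intersecting with \<^term>\<open>aleph N\<close> only matters for \<^prop>\<open>N = (0::nat)\<close>, where the
  empty intersection of subsets of \<^term>\<open>aleph N\<close> has to be \<^term>\<open>aleph N\<close>.\<close>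

definition monomial_sum_set_fin :: "nat \<Rightarrow> nat \<Rightarrow> (nat \<Rightarrow> nat \<Rightarrow> expo) \<Rightarrow> nat set" where
  "monomial_sum_set_fin N m U =
     (\<Union>i\<in>{1..m}. aleph N \<inter> (\<Inter>j\<in>{1..N}. digit_set_fin N j (U i j)))"

definition monomial_sum_set :: "nat \<Rightarrow> nat \<Rightarrow> (nat \<Rightarrow> nat \<Rightarrow> expo) \<Rightarrow> nat set" where
  "monomial_sum_set N m U = (\<Union>i\<in>{1..m}. \<Inter>j\<in>{1..N}. digit_set j (U i j))"

text \<open>The sets \<open>A\<^sub>\<alpha>\<^sup>(\<^sup>N\<^sup>)\<close> and \<open>A\<^sub>\<alpha>\<close> of an element of \<^term>\<open>Sc N\<close>. Every such element is
  a sum of monomials, and the sets do not depend on the chosen sum: see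
  \<open>monomial_sum_ex\<close>, \<open>A_fin_monomial_sum\<close> and \<open>A_inf_monomial_sum\<close> below.\<close>

definition A_fin :: "nat \<Rightarrow> ic_elem \<Rightarrow> nat set" where
  "A_fin N \<alpha> = (THE A. \<exists>m U. \<alpha> = monomial_sum N m U \<and> A = monomial_sum_set_fin N m U)"

definition A_inf :: "nat \<Rightarrow> ic_elem \<Rightarrow> nat set" where
  "A_inf N \<alpha> = (THE A. \<exists>m U. \<alpha> = monomial_sum N m U \<and> A = monomial_sum_set N m U)"


section \<open>Basic facts\<close>

subsection \<open>Freeness\<close>

lemma ic_terms_simps [simp]:
  "Atom a \<in> ic_terms V \<longleftrightarrow> a \<in> V"
  "Zero \<in> ic_terms V"
  "One \<in> ic_terms V"
  "Plus s t \<in> ic_terms V \<longleftrightarrow> s \<in> ic_terms V \<and> t \<in> ic_terms V"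
  "Times s t \<in> ic_terms V \<longleftrightarrow> s \<in> ic_terms V \<and> t \<in> ic_terms V"
  "Compl s \<in> ic_terms V \<longleftrightarrow> s \<in> ic_terms V"
  by (auto simp: ic_terms_def)

lemma ic_terms_mono: "V \<subseteq> W \<Longrightarrow> ic_terms V \<subseteq> ic_terms W"
  by (auto simp: ic_terms_def)

lemma ic_eq_terms: "ic_eq V s t \<Longrightarrow> s \<in> ic_terms V \<and> t \<in> ic_terms V"
  by (induction rule: ic_eq.induct) auto

lemma ic_eq_mono:
  assumes "ic_eq V s t" and "V \<subseteq> W"
  shows "ic_eq W s t"
  using assms(1)
proof (induction rule: ic_eq.induct)
  case sym then show ?case by (blast intro: ic_eq.sym)
next
  case trans then show ?case by (blast intro: ic_eq.trans)
qed (simp_all add: ic_eq.intros(1,4-18) subsetD[OF ic_terms_mono[OF assms(2)]])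

lemma ic_class_eq_iff:
  assumes "s \<in> ic_terms V"
  shows "ic_class V s = ic_class V t \<longleftrightarrow> ic_eq V s t"
  using assms unfolding ic_class_def
  by (blast intro: ic_eq.refl ic_eq.sym ic_eq.trans)

lemma ic_class_UN:
  assumes "s \<in> ic_terms V" and "\<And>s'. ic_eq V s s' \<Longrightarrow> f s' = f s"
  shows "(\<Union>s'\<in>ic_class V s. f s') = f s"
  unfolding ic_class_def using assms(2) ic_eq.refl[OF assms(1)] by blast

lemma ic_free_op:
  assumes "s \<in> ic_terms V" and "t \<in> ic_terms V"
    and "\<And>s' t'. ic_eq V s s' \<Longrightarrow> ic_eq V t t' \<Longrightarrow> ic_eq V (g s t) (g s' t')"
    and "g s t \<in> ic_terms V"
  shows "(\<Union>s'\<in>ic_class V s. \<Union>t'\<in>ic_class V t. ic_class V (g s' t')) = ic_class V (g s t)"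
proof -
  have "ic_class V (g s' t') = ic_class V (g s t)" if "ic_eq V s s'" "ic_eq V t t'" for s' t'
    using ic_class_eq_iff[OF assms(4)] assms(3)[OF that] by metis
  then show ?thesis
    unfolding ic_class_def[of V s] ic_class_def[of V t]
    using ic_eq.refl[OF assms(1)] ic_eq.refl[OF assms(2)] by blast
qed

text \<open>\<open>R\<close> is, via \<open>L\<close>, the algebra of terms over \<open>V\<close> modulo \<^term>\<open>ic_eq V\<close>.\<close>

locale ic_presentation =
  fixes V :: "'a set" and R :: "('b, 'm) ring_scheme" (structure) and L :: "'a ic_term \<Rightarrow> 'b"
  assumes carrier: "carrier R = L ` ic_terms V"
    and L_eq_iff: "s \<in> ic_terms V \<Longrightarrow> t \<in> ic_terms V \<Longrightarrow> L s = L t \<longleftrightarrow> ic_eq V s t"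
    and L_Zero: "L Zero = \<zero>"
    and L_One: "L One = \<one>"
    and L_Plus: "s \<in> ic_terms V \<Longrightarrow> t \<in> ic_terms V \<Longrightarrow> L (Plus s t) = L s \<oplus> L t"
    and L_Times: "s \<in> ic_terms V \<Longrightarrow> t \<in> ic_terms V \<Longrightarrow> L (Times s t) = L s \<otimes> L t"
begin

lemma L_eqI: "ic_eq V s t \<Longrightarrow> L s = L t"
  using L_eq_iff ic_eq_terms by blast

lemma L_laws:
  assumes "s \<in> ic_terms V" "t \<in> ic_terms V" "u \<in> ic_terms V"
  shows "(L s \<oplus> L t) \<oplus> L u = L s \<oplus> (L t \<oplus> L u)" "L s \<oplus> L t = L t \<oplus> L s" "\<zero> \<oplus> L s = L s"
    "(L s \<otimes> L t) \<otimes> L u = L s \<otimes> (L t \<otimes> L u)" "L s \<otimes> L t = L t \<otimes> L s" "\<one> \<otimes> L s = L s"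
    "(L s \<oplus> L t) \<otimes> L u = L s \<otimes> L u \<oplus> L t \<otimes> L u" "\<zero> \<otimes> L s = \<zero>"
    "L s \<otimes> L (Compl s) = \<zero>" "L s \<oplus> L (Compl s) = \<one>" "L s \<otimes> L s = L s" "L s \<oplus> L s = L s"
  using assms L_eqI[OF ic_eq.Plus_assoc[of s V t u]] L_eqI[OF ic_eq.Plus_commute[of s V t]]
    L_eqI[OF ic_eq.Plus_Zero[of s V]] L_eqI[OF ic_eq.Times_assoc[of s V t u]]
    L_eqI[OF ic_eq.Times_commute[of s V t]] L_eqI[OF ic_eq.Times_One[of s V]]
    L_eqI[OF ic_eq.distrib[of s V t u]] L_eqI[OF ic_eq.Times_Zero[of s V]]
    L_eqI[OF ic_eq.Times_Compl[of s V]] L_eqI[OF ic_eq.Plus_Compl[of s V]]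
    L_eqI[OF ic_eq.Times_idem[of s V]] L_eqI[OF ic_eq.Plus_idem[of s V]]
  by (simp_all add: L_Plus L_Times L_Zero L_One)

lemma L_closed: "s \<in> ic_terms V \<Longrightarrow> L s \<in> carrier R"
  by (simp add: carrier)

lemma is_ic_semiring: "ic_semiring R"
proof -
  have cl: "a \<oplus> b \<in> carrier R" "a \<otimes> b \<in> carrier R"
    if ab: "a \<in> carrier R" "b \<in> carrier R" for a b
  proof -
    obtain s t where "s \<in> ic_terms V" "t \<in> ic_terms V" "a = L s" "b = L t"
      using ab by (auto simp: carrier)
    then show "a \<oplus> b \<in> carrier R" "a \<otimes> b \<in> carrier R"
      using L_closed[of "Plus s t"] L_closed[of "Times s t"] by (simp_all add: L_Plus L_Times)
  qed
  have zo: "\<zero> \<in> carrier R" "\<one> \<in> carrier R"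
    using L_closed[of Zero] L_closed[of One] by (simp_all add: L_Zero L_One)
  interpret abelian_monoid R
  proof (rule abelian_monoidI)
    fix x y z assume "x \<in> carrier R" "y \<in> carrier R" "z \<in> carrier R"
    then show "x \<oplus> y \<oplus> z = x \<oplus> (y \<oplus> z)" by (auto simp: carrier L_laws(1))
  next
    fix x y assume "x \<in> carrier R" "y \<in> carrier R"
    then show "x \<oplus> y = y \<oplus> x" by (auto simp: carrier intro: L_laws(2))
  next
    fix x assume "x \<in> carrier R"
    then show "\<zero> \<oplus> x = x" by (auto simp: carrier L_laws(3))
  qed (use cl zo in auto)
  interpret comm_monoid R
  proof (rule comm_monoidI)
    fix x y z assume "x \<in> carrier R" "y \<in> carrier R" "z \<in> carrier R"
    then show "x \<otimes> y \<otimes> z = x \<otimes> (y \<otimes> z)" by (auto simp: carrier L_laws(4))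
  next
    fix x y assume "x \<in> carrier R" "y \<in> carrier R"
    then show "x \<otimes> y = y \<otimes> x" by (auto simp: carrier intro: L_laws(5))
  next
    fix x assume "x \<in> carrier R"
    then show "\<one> \<otimes> x = x" by (auto simp: carrier L_laws(6))
  qed (use cl zo in auto)
  show ?thesis
  proof
    fix x y z assume x: "x \<in> carrier R" and y: "y \<in> carrier R" and z: "z \<in> carrier R"
    show *: "(x \<oplus> y) \<otimes> z = x \<otimes> z \<oplus> y \<otimes> z"
      using x y z by (auto simp: carrier L_laws(7))
    show "z \<otimes> (x \<oplus> y) = z \<otimes> x \<oplus> z \<otimes> y"
      using * x y z cl by (simp add: m_comm)
  next
    fix x assume x: "x \<in> carrier R"
    show *: "\<zero> \<otimes> x = \<zero>"
      using x by (auto simp: carrier L_laws(8))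
    show "x \<otimes> \<zero> = \<zero>"
      using * x zo by (simp add: m_comm)
    obtain s where s: "s \<in> ic_terms V" "x = L s"
      using x by (auto simp: carrier)
    show "\<exists>c\<in>carrier R. x \<otimes> c = \<zero> \<and> x \<oplus> c = \<one>"
      using s L_laws(9,10)[of s] by (intro bexI[of _ "L (Compl s)"]) (auto simp: carrier)
    show "x \<otimes> x = x" "x \<oplus> x = x"
      using s L_laws(11,12)[of s] by auto
  qed
qed

end

lemma (in ic_semiring) compl_unique:
  assumes "s \<in> carrier R" "c \<in> carrier R" "d \<in> carrier R"
    and "s \<otimes> c = \<zero>" "s \<oplus> c = \<one>" "s \<otimes> d = \<zero>" "s \<oplus> d = \<one>"
  shows "c = d"
proof -
  have "c = c \<otimes> (s \<oplus> d)" using assms(2,7) by simp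
  also have "\<dots> = s \<otimes> c \<oplus> c \<otimes> d" using assms(1-3) by (simp add: r_distr m_comm)
  also have "\<dots> = s \<otimes> d \<oplus> c \<otimes> d" using assms by simp
  also have "\<dots> = (s \<oplus> c) \<otimes> d" using assms(1-3) by (simp add: l_distr)
  also have "\<dots> = d" using assms by simp
  finally show ?thesis .
qed

lemma (in ic_semiring) add_one:
  assumes "s \<in> carrier R"
  shows "s \<oplus> \<one> = \<one>"
proof -
  obtain c where c: "c \<in> carrier R" "s \<oplus> c = \<one>" using compl_ex[OF assms] by blast
  have "s \<oplus> (s \<oplus> c) = s \<oplus> c"
    using assms c(1) a_assoc[OF assms assms c(1)] by (simp add: add_idem)
  then show ?thesis using c(2) by simp
qed

lemma (in ic_semiring) de_morgan:
  assumes [simp]: "a \<in> carrier R" "b \<in> carrier R" "a' \<in> carrier R" "b' \<in> carrier R"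
    and "a \<otimes> a' = \<zero>" "a \<oplus> a' = \<one>" "b \<otimes> b' = \<zero>" "b \<oplus> b' = \<one>"
  shows "(a \<oplus> b) \<otimes> (a' \<otimes> b') = \<zero>" "(a \<oplus> b) \<oplus> (a' \<otimes> b') = \<one>"
proof -
  have "(a \<oplus> b) \<otimes> (a' \<otimes> b') = (a \<otimes> a') \<otimes> b' \<oplus> (b \<otimes> b') \<otimes> a'"
    by (simp add: l_distr r_distr m_ac)
  then show "(a \<oplus> b) \<otimes> (a' \<otimes> b') = \<zero>" using assms by simp
  have "(a \<oplus> b) \<oplus> (a' \<otimes> b') = (a \<oplus> b) \<otimes> \<one> \<oplus> a' \<otimes> b'" by simp
  also have "\<dots> = a \<otimes> (b' \<oplus> \<one>) \<oplus> b \<oplus> a' \<otimes> b'"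
    by (simp add: add_one)
  also have "\<dots> = (a \<oplus> a') \<otimes> b' \<oplus> a \<oplus> b"
    by (simp add: l_distr r_distr a_ac)
  also have "\<dots> = a \<oplus> (b \<oplus> b')" using assms(6) by (simp add: a_ac)
  also have "\<dots> = \<one>" using assms(8) by (simp add: add_one)
  finally show "(a \<oplus> b) \<oplus> (a' \<otimes> b') = \<one>" .
qed

text \<open>Values of terms in an I-C semiring under an assignment of the atoms.\<close>

primrec ic_value :: "('b, 'm) ring_scheme \<Rightarrow> ('a \<Rightarrow> 'b) \<Rightarrow> 'a ic_term \<Rightarrow> 'b" where
  "ic_value S g (Atom a) = g a"
| "ic_value S g Zero = \<zero>\<^bsub>S\<^esub>"
| "ic_value S g One = \<one>\<^bsub>S\<^esub>"
| "ic_value S g (Plus s t) = ic_value S g s \<oplus>\<^bsub>S\<^esub> ic_value S g t"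
| "ic_value S g (Times s t) = ic_value S g s \<otimes>\<^bsub>S\<^esub> ic_value S g t"
| "ic_value S g (Compl s) =
     (SOME c. c \<in> carrier S \<and> ic_value S g s \<otimes>\<^bsub>S\<^esub> c = \<zero>\<^bsub>S\<^esub> \<and> ic_value S g s \<oplus>\<^bsub>S\<^esub> c = \<one>\<^bsub>S\<^esub>)"

context ic_semiring
begin

lemma some_compl:
  assumes "s \<in> carrier R"
  defines "c \<equiv> SOME c. c \<in> carrier R \<and> s \<otimes> c = \<zero> \<and> s \<oplus> c = \<one>"
  shows "c \<in> carrier R" "s \<otimes> c = \<zero>" "s \<oplus> c = \<one>"
  using someI_ex[of "\<lambda>c. c \<in> carrier R \<and> s \<otimes> c = \<zero> \<and> s \<oplus> c = \<one>"] compl_ex[OF assms(1)]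
  unfolding c_def by blast+

lemma ic_value_closed:
  assumes "g \<in> V \<rightarrow> carrier R" and "t \<in> ic_terms V"
  shows "ic_value R g t \<in> carrier R"
  using assms(2) by (induction t) (use assms(1) some_compl(1) in auto)

lemma ic_value_eq:
  assumes "ic_eq V s t" and g: "g \<in> V \<rightarrow> carrier R"
  shows "ic_value R g s = ic_value R g t"
  using assms(1)
proof (induction rule: ic_eq.induct)
  case (Times_Compl s)
  then show ?case using some_compl(2)[OF ic_value_closed[OF g]] by simp
next
  case (Plus_Compl s)
  then show ?case using some_compl(3)[OF ic_value_closed[OF g]] by simp
next
  case Plus_assoc then show ?case by (simp add: ic_value_closed[OF g] a_assoc)
next
  case Plus_commute then show ?case by (simp add: ic_value_closed[OF g] a_comm)
next
  case Times_assoc then show ?case by (simp add: ic_value_closed[OF g] m_assoc)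
next
  case Times_commute then show ?case by (simp add: ic_value_closed[OF g] m_comm)
qed (simp_all add: ic_value_closed[OF g] l_distr mult_idem add_idem)

end

text \<open>The universal property: an assignment of the atoms in any I-C semiring extends
  uniquely to a homomorphism.\<close>

theorem (in ic_presentation) universal_property:
  assumes "ic_semiring S" and g: "g \<in> V \<rightarrow> carrier S"
  shows "\<exists>h. h \<in> ring_hom R S \<and> h \<zero> = \<zero>\<^bsub>S\<^esub> \<and> (\<forall>a\<in>V. h (L (Atom a)) = g a) \<and>
    (\<forall>h'. h' \<in> ring_hom R S \<and> h' \<zero> = \<zero>\<^bsub>S\<^esub> \<and> (\<forall>a\<in>V. h' (L (Atom a)) = g a) \<longrightarrow>
      (\<forall>x\<in>carrier R. h' x = h x))"
proof -
  interpret S: ic_semiring S by fact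
  define h where "h x = ic_value S g (SOME s. s \<in> ic_terms V \<and> L s = x)" for x
  have h: "h (L s) = ic_value S g s" if s: "s \<in> ic_terms V" for s
  proof -
    define s' where "s' = (SOME s'. s' \<in> ic_terms V \<and> L s' = L s)"
    have "s' \<in> ic_terms V \<and> L s' = L s"
      unfolding s'_def by (rule someI[of _ s]) (use s in simp)
    then have "ic_eq V s' s" using L_eq_iff s by blast
    then show ?thesis using S.ic_value_eq[OF _ g] by (simp add: h_def s'_def)
  qed
  have hom: "h \<in> ring_hom R S"
  proof (rule ring_hom_memI)
    fix x assume "x \<in> carrier R"
    then show "h x \<in> carrier S"
      using S.ic_value_closed[OF g] by (auto simp: carrier h)
  next
    fix x y assume "x \<in> carrier R" "y \<in> carrier R"
    then obtain s t where st: "s \<in> ic_terms V" "t \<in> ic_terms V" "x = L s" "y = L t"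
      by (auto simp: carrier)
    show "h (x \<otimes> y) = h x \<otimes>\<^bsub>S\<^esub> h y"
      using st h[of "Times s t"] by (simp add: h L_Times)
    show "h (x \<oplus> y) = h x \<oplus>\<^bsub>S\<^esub> h y"
      using st h[of "Plus s t"] by (simp add: h L_Plus)
  next
    show "h \<one> = \<one>\<^bsub>S\<^esub>" using h[of One] by (simp add: L_One)
  qed
  have zero: "h \<zero> = \<zero>\<^bsub>S\<^esub>" using h[of Zero] by (simp add: L_Zero)
  have uniq: "h' (L s) = h (L s)"
    if h': "h' \<in> ring_hom R S" "h' \<zero> = \<zero>\<^bsub>S\<^esub>" "\<forall>a\<in>V. h' (L (Atom a)) = g a"
      and s: "s \<in> ic_terms V" for h' s
    using s
  proof (induction s)
    case Zero
    then show ?case using zero h'(2) by (simp add: L_Zero)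
  next
    case One
    then show ?case using ring_hom_one[OF h'(1)] ring_hom_one[OF hom] by (simp add: L_One)
  next
    case (Plus s t)
    then show ?case
      using ring_hom_add[OF h'(1)] ring_hom_add[OF hom] by (simp add: L_Plus L_closed)
  next
    case (Times s t)
    then show ?case
      using ring_hom_mult[OF h'(1)] ring_hom_mult[OF hom] by (simp add: L_Times L_closed)
  next
    case (Compl s)
    have s: "s \<in> ic_terms V" using Compl by simp
    have c: "f (L s) \<in> carrier S" "f (L (Compl s)) \<in> carrier S"
        "f (L s) \<otimes>\<^bsub>S\<^esub> f (L (Compl s)) = \<zero>\<^bsub>S\<^esub>" "f (L s) \<oplus>\<^bsub>S\<^esub> f (L (Compl s)) = \<one>\<^bsub>S\<^esub>"
      if f: "f \<in> ring_hom R S" "f \<zero> = \<zero>\<^bsub>S\<^esub>" for f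
    proof -
      have 1: "L s \<in> carrier R" "L (Compl s) \<in> carrier R" using s by (simp_all add: L_closed)
      then show "f (L s) \<in> carrier S" "f (L (Compl s)) \<in> carrier S"
        using ring_hom_closed[OF f(1)] by simp_all
      show "f (L s) \<otimes>\<^bsub>S\<^esub> f (L (Compl s)) = \<zero>\<^bsub>S\<^esub>"
        using ring_hom_mult[OF f(1) 1] L_laws(9)[OF s s s] f(2) by simp
      show "f (L s) \<oplus>\<^bsub>S\<^esub> f (L (Compl s)) = \<one>\<^bsub>S\<^esub>"
        using ring_hom_add[OF f(1) 1] L_laws(10)[OF s s s] ring_hom_one[OF f(1)] by simp
    qed
    show ?case
      using c[OF h'(1,2)] c[OF hom zero] Compl.IH[OF s] S.compl_unique by metis
  qed (use h h'(3) in simp)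
  show ?thesis
  proof (intro exI[of _ h] conjI allI impI ballI)
    show "h (L (Atom a)) = g a" if "a \<in> V" for a
      using h[of "Atom a"] that by simp
  next
    fix h' x
    assume "h' \<in> ring_hom R S \<and> h' \<zero> = \<zero>\<^bsub>S\<^esub> \<and> (\<forall>a\<in>V. h' (L (Atom a)) = g a)"
      and "x \<in> carrier R"
    then show "h' x = h x" using uniq by (auto simp only: carrier)
  qed (fact hom zero)+
qed

lemma ic_free_presentation: "ic_presentation V (ic_free V) (ic_class V)"
proof
  show "ic_class V (Plus s t) = ic_class V s \<oplus>\<^bsub>ic_free V\<^esub> ic_class V t"
    if "s \<in> ic_terms V" "t \<in> ic_terms V" for s t
    using ic_free_op[OF that, of Plus] that by (simp add: ic_free_def ic_eq.Plus_cong)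
  show "ic_class V (Times s t) = ic_class V s \<otimes>\<^bsub>ic_free V\<^esub> ic_class V t"
    if "s \<in> ic_terms V" "t \<in> ic_terms V" for s t
    using ic_free_op[OF that, of Times] that by (simp add: ic_free_def ic_eq.Times_cong)
qed (simp_all add: ic_free_def ic_class_eq_iff)

lemma ic_free_ic_semiring: "ic_semiring (ic_free V)"
  using ic_free_presentation by (rule ic_presentation.is_ic_semiring)

subsection \<open>The direct limit\<close>

context
  notes One_nat_def [simp del]
begin

lemma Sc_carrier: "\<alpha> \<in> carrier (Sc N) \<longleftrightarrow> (\<exists>t\<in>ic_terms {1..N}. \<alpha> = ic_class {1..N} t)"
  by (auto simp: ic_free_def)

lemma Sc_terms_mono: "N \<le> M \<Longrightarrow> t \<in> ic_terms {1..N} \<Longrightarrow> t \<in> ic_terms {1..M::nat}"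
  using ic_terms_mono[of "{1..N}" "{1..M}"] by auto

lemma Sc_emb_class:
  assumes "t \<in> ic_terms {1..N}" "N \<le> M"
  shows "Sc_emb N M (ic_class {1..N} t) = ic_class {1..M} t"
  unfolding Sc_emb_def
proof (rule ic_class_UN[OF assms(1)])
  fix s assume "ic_eq {1..N} t s"
  then have "ic_eq {1..M} t s" using assms(2) by (auto intro: ic_eq_mono)
  then show "ic_class {1..M} s = ic_class {1..M} t"
    using ic_class_eq_iff[OF Sc_terms_mono[OF assms(2,1)]] by metis
qed

lemma Sc_emb_ring_hom:
  assumes "N \<le> M"
  shows "Sc_emb N M \<in> ring_hom (Sc N) (Sc M)" and "Sc_emb N M \<zero>\<^bsub>Sc N\<^esub> = \<zero>\<^bsub>Sc M\<^esub>"
proof -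
  interpret N: ic_presentation "{1..N}" "Sc N" "ic_class {1..N}" by (rule ic_free_presentation)
  interpret M: ic_presentation "{1..M}" "Sc M" "ic_class {1..M}" by (rule ic_free_presentation)
  note emb = Sc_emb_class[OF _ assms] Sc_terms_mono[OF assms]
  show "Sc_emb N M \<in> ring_hom (Sc N) (Sc M)"
  proof (rule ring_hom_memI)
    fix x y assume "x \<in> carrier (Sc N)" "y \<in> carrier (Sc N)"
    then obtain s t where st: "s \<in> ic_terms {1..N}" "t \<in> ic_terms {1..N}"
        "x = ic_class {1..N} s" "y = ic_class {1..N} t"
      by (auto simp: N.carrier)
    show "Sc_emb N M (x \<otimes>\<^bsub>Sc N\<^esub> y) = Sc_emb N M x \<otimes>\<^bsub>Sc M\<^esub> Sc_emb N M y"
      using st emb(1)[of "Times s t"] by (simp add: N.L_Times M.L_Times emb)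
    show "Sc_emb N M (x \<oplus>\<^bsub>Sc N\<^esub> y) = Sc_emb N M x \<oplus>\<^bsub>Sc M\<^esub> Sc_emb N M y"
      using st emb(1)[of "Plus s t"] by (simp add: N.L_Plus M.L_Plus emb)
  next
    show "Sc_emb N M \<one>\<^bsub>Sc N\<^esub> = \<one>\<^bsub>Sc M\<^esub>"
      using emb(1)[of One] by (simp add: N.L_One M.L_One)
  qed (auto simp: N.carrier M.carrier emb)
  show "Sc_emb N M \<zero>\<^bsub>Sc N\<^esub> = \<zero>\<^bsub>Sc M\<^esub>"
    using emb(1)[of Zero] by (simp add: N.L_Zero M.L_Zero)
qed

lemma ic_terms_finite_index: "t \<in> ic_terms {1..} \<Longrightarrow> \<exists>N. t \<in> ic_terms {1..N::nat}"
proof (induction t)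
  case (Plus s t)
  then obtain N M where "s \<in> ic_terms {1..N}" "t \<in> ic_terms {1..M}" by auto
  then show ?case
    using Sc_terms_mono[of N "max N M" s] Sc_terms_mono[of M "max N M" t] by auto
next
  case (Times s t)
  then obtain N M where "s \<in> ic_terms {1..N}" "t \<in> ic_terms {1..M}" by auto
  then show ?case
    using Sc_terms_mono[of N "max N M" s] Sc_terms_mono[of M "max N M" t] by auto
qed auto

text \<open>Additional atoms do not identify more terms: replace them by \<^term>\<open>One\<close>.\<close>

primrec restrict_atoms :: "'a set \<Rightarrow> 'a ic_term \<Rightarrow> 'a ic_term" where
  "restrict_atoms V (Atom a) = (if a \<in> V then Atom a else One)"
| "restrict_atoms V Zero = Zero"
| "restrict_atoms V One = One"
| "restrict_atoms V (Plus s t) = Plus (restrict_atoms V s) (restrict_atoms V t)"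
| "restrict_atoms V (Times s t) = Times (restrict_atoms V s) (restrict_atoms V t)"
| "restrict_atoms V (Compl s) = Compl (restrict_atoms V s)"

lemma restrict_atoms_terms [simp]: "restrict_atoms V t \<in> ic_terms V"
  by (induction t) auto

lemma restrict_atoms_id: "t \<in> ic_terms V \<Longrightarrow> restrict_atoms V t = t"
  by (induction t) auto

lemma ic_eq_restrict_atoms:
  assumes "ic_eq W s t"
  shows "ic_eq V (restrict_atoms V s) (restrict_atoms V t)"
  using assms
proof (induction rule: ic_eq.induct)
  case sym then show ?case by (blast intro: ic_eq.sym)
next
  case trans then show ?case by (blast intro: ic_eq.trans)
qed (simp_all add: ic_eq.intros(1,4-18))

lemma ic_eq_conservative:
  assumes "ic_eq W s t" "s \<in> ic_terms V" "t \<in> ic_terms V"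
  shows "ic_eq V s t"
  using ic_eq_restrict_atoms[OF assms(1), of V] assms(2,3) by (simp add: restrict_atoms_id)

definition Sc_lim_term :: "nat ic_term \<Rightarrow> (ic_elem \<times> nat) set" where
  "Sc_lim_term t = {(ic_class {1..M} s, M) | s M. s \<in> ic_terms {1..M} \<and> ic_eq {1..} t s}"

lemma Sc_class_term:
  assumes t: "t \<in> ic_terms {1..N}"
  shows "Sc_class (ic_class {1..N} t) N = Sc_lim_term t"
proof -
  have *: "(\<exists>K. N \<le> K \<and> M \<le> K \<and>
      Sc_emb N K (ic_class {1..N} t) = Sc_emb M K (ic_class {1..M} s)) \<longleftrightarrow> ic_eq {1..} t s"
    if s: "s \<in> ic_terms {1..M}" for s M
  proof
    assume "\<exists>K. N \<le> K \<and> M \<le> K \<and>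
      Sc_emb N K (ic_class {1..N} t) = Sc_emb M K (ic_class {1..M} s)"
    then obtain K where K: "N \<le> K" "M \<le> K" "ic_class {1..K} t = ic_class {1..K} s"
      using s t by (auto simp: Sc_emb_class)
    then have "ic_eq {1..K} t s"
      using ic_class_eq_iff[OF Sc_terms_mono[OF K(1) t]] by simp
    then show "ic_eq {1..} t s" by (auto intro: ic_eq_mono)
  next
    assume "ic_eq {1..} t s"
    define K' where "K' = max N M"
    have "t \<in> ic_terms {1..K'}" "s \<in> ic_terms {1..K'}"
      using Sc_terms_mono[OF _ t, of K'] Sc_terms_mono[OF _ s, of K'] by (auto simp: K'_def)
    then have K': "ic_eq {1..K'} t s" using \<open>ic_eq {1..} t s\<close> by (blast intro: ic_eq_conservative)
    have "N \<le> K'" "M \<le> K'" by (auto simp: K'_def)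
    then show "\<exists>K. N \<le> K \<and> M \<le> K \<and>
      Sc_emb N K (ic_class {1..N} t) = Sc_emb M K (ic_class {1..M} s)"
      using s t K' ic_class_eq_iff[of t "{1..K'}" s] ic_eq_terms[OF K']
      by (intro exI[of _ K']) (simp add: Sc_emb_class)
  qed
  have "(\<beta>, M) \<in> Sc_class (ic_class {1..N} t) N \<longleftrightarrow> (\<beta>, M) \<in> Sc_lim_term t" for \<beta> M
    using t * unfolding Sc_class_def Sc_rel_def Sc_lim_term_def
    by (auto simp: Sc_carrier)
  then show ?thesis by auto
qed

lemma Sc_lim_term_eq_iff:
  assumes "s \<in> ic_terms {1..}" "t \<in> ic_terms {1..}"
  shows "Sc_lim_term s = Sc_lim_term t \<longleftrightarrow> ic_eq {1..} s t"
proof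
  assume eq: "Sc_lim_term s = Sc_lim_term t"
  obtain N where N: "t \<in> ic_terms {1..N}" using assms(2) ic_terms_finite_index by blast
  have "(ic_class {1..N} t, N) \<in> Sc_lim_term t"
    using N assms(2) unfolding Sc_lim_term_def by (blast intro: ic_eq.refl)
  then have "(ic_class {1..N} t, N) \<in> Sc_lim_term s" using eq by simp
  then obtain u where u: "u \<in> ic_terms {1..N}" "ic_eq {1..} s u"
      "ic_class {1..N} t = ic_class {1..N} u"
    by (auto simp: Sc_lim_term_def)
  then have "ic_eq {1..N} t u" using ic_class_eq_iff[OF N] by simp
  then have "ic_eq {1..} t u" by (auto intro: ic_eq_mono)
  then show "ic_eq {1..} s t" using u(2) by (blast intro: ic_eq.sym ic_eq.trans)
next
  assume st: "ic_eq {1..} s t"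
  have "ic_eq {1..} s u \<longleftrightarrow> ic_eq {1..} t u" for u
    using st by (blast intro: ic_eq.sym ic_eq.trans)
  then show "Sc_lim_term s = Sc_lim_term t" by (simp add: Sc_lim_term_def)
qed

lemma Sc_lim_op:
  assumes st: "s \<in> ic_terms {1..}" "t \<in> ic_terms {1..}"
    and op: "\<And>K s t. s \<in> ic_terms {1..K} \<Longrightarrow> t \<in> ic_terms {1..K} \<Longrightarrow>
      op K (ic_class {1..K} s) (ic_class {1..K} t) = ic_class {1..K} (g s t)"
    and g: "\<And>K s t. s \<in> ic_terms {1..K} \<Longrightarrow> t \<in> ic_terms {1..K} \<Longrightarrow> g s t \<in> ic_terms {1..K}"
    and cong: "\<And>s' t'. ic_eq {1..} s s' \<Longrightarrow> ic_eq {1..} t t' \<Longrightarrow> ic_eq {1..} (g s t) (g s' t')"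
  shows "(\<Union>(\<alpha>, N)\<in>Sc_lim_term s. \<Union>(\<beta>, M)\<in>Sc_lim_term t.
      Sc_class (op (max N M) (Sc_emb N (max N M) \<alpha>) (Sc_emb M (max N M) \<beta>)) (max N M))
    = Sc_lim_term (g s t)"
proof -
  have *: "Sc_class (op (max N M) (Sc_emb N (max N M) \<alpha>) (Sc_emb M (max N M) \<beta>)) (max N M)
      = Sc_lim_term (g s t)"
    if "(\<alpha>, N) \<in> Sc_lim_term s" "(\<beta>, M) \<in> Sc_lim_term t" for \<alpha> \<beta> N M
  proof -
    obtain s' t' where s': "s' \<in> ic_terms {1..N}" "ic_eq {1..} s s'" "\<alpha> = ic_class {1..N} s'"
        and t': "t' \<in> ic_terms {1..M}" "ic_eq {1..} t t'" "\<beta> = ic_class {1..M} t'"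
      using \<open>(\<alpha>, N) \<in> Sc_lim_term s\<close> \<open>(\<beta>, M) \<in> Sc_lim_term t\<close> by (auto simp: Sc_lim_term_def)
    let ?K = "max N M"
    have 1: "s' \<in> ic_terms {1..?K}" "t' \<in> ic_terms {1..?K}"
      using Sc_terms_mono[OF _ s'(1), of ?K] Sc_terms_mono[OF _ t'(1), of ?K] by auto
    have 2: "ic_eq {1..} (g s t) (g s' t')" using cong s'(2) t'(2) by simp
    have "Sc_class (op ?K (Sc_emb N ?K \<alpha>) (Sc_emb M ?K \<beta>)) ?K = Sc_lim_term (g s' t')"
      using s' t' 1 by (simp add: Sc_emb_class op Sc_class_term g)
    also have "\<dots> = Sc_lim_term (g s t)"
      using Sc_lim_term_eq_iff 2 ic_eq_terms[OF 2] by blast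
    finally show ?thesis .
  qed
  obtain N M where "s \<in> ic_terms {1..N}" "t \<in> ic_terms {1..M}"
    using st ic_terms_finite_index by meson
  then have ne: "(ic_class {1..N} s, N) \<in> Sc_lim_term s" "(ic_class {1..M} t, M) \<in> Sc_lim_term t"
    using st unfolding Sc_lim_term_def by (blast intro: ic_eq.refl)+
  have const: "(\<Union>(\<gamma>, K)\<in>X. F \<gamma> K) = A"
    if "\<And>\<gamma> K. (\<gamma>, K) \<in> X \<Longrightarrow> F \<gamma> K = A" and "p \<in> X"
    for X :: "(ic_elem \<times> nat) set" and F :: "ic_elem \<Rightarrow> nat \<Rightarrow> (ic_elem \<times> nat) set" and A p
  proof -
    have "(\<Union>(\<gamma>, K)\<in>X. F \<gamma> K) = (\<Union>_\<in>X. A)"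
      by (rule SUP_cong) (auto simp: that(1))
    then show ?thesis using that(2) by auto
  qed
  show ?thesis
    by (rule const[OF const[OF *] ne(1)], assumption, assumption, rule ne(2))
qed

lemma Sc_lim_presentation: "ic_presentation {1..} Sc_lim Sc_lim_term"
proof
  show "carrier Sc_lim = Sc_lim_term ` ic_terms {1..}"
  proof (intro Set.set_eqI iffI)
    fix A assume "A \<in> carrier Sc_lim"
    then obtain \<alpha> N where "\<alpha> \<in> carrier (Sc N)" "A = Sc_class \<alpha> N"
      by (auto simp: Sc_lim_def quotient_def Sc_class_def)
    then obtain t where "t \<in> ic_terms {1..N}" "A = Sc_lim_term t"
      by (auto simp: Sc_carrier Sc_class_term)
    then show "A \<in> Sc_lim_term ` ic_terms {1..}"
      using ic_terms_mono[of "{1..N}" "{1..}"] by auto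
  next
    fix A assume "A \<in> Sc_lim_term ` ic_terms {1..}"
    then obtain t N where t: "t \<in> ic_terms {1..N}" "A = Sc_lim_term t"
      using ic_terms_finite_index by blast
    have "ic_class {1..N} t \<in> carrier (Sc N)" using t by (auto simp: Sc_carrier)
    then show "A \<in> carrier Sc_lim"
      using Sc_class_term[OF t(1)] t(2) by (auto simp: Sc_lim_def quotient_def Sc_class_def)
  qed
  show "Sc_lim_term Zero = \<zero>\<^bsub>Sc_lim\<^esub>" "Sc_lim_term One = \<one>\<^bsub>Sc_lim\<^esub>"
    using Sc_class_term[of Zero 0] Sc_class_term[of One 0] by (simp_all add: Sc_lim_def ic_free_def)
  note pres = ic_free_presentation
  show "Sc_lim_term (Plus s t) = Sc_lim_term s \<oplus>\<^bsub>Sc_lim\<^esub> Sc_lim_term t"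
    if "s \<in> ic_terms {1..}" "t \<in> ic_terms {1..}" for s t
    using Sc_lim_op[OF that, of "\<lambda>K. add (Sc K)" Plus]
    by (simp add: Sc_lim_def ic_eq.Plus_cong ic_presentation.L_Plus[OF pres])
  show "Sc_lim_term (Times s t) = Sc_lim_term s \<otimes>\<^bsub>Sc_lim\<^esub> Sc_lim_term t"
    if "s \<in> ic_terms {1..}" "t \<in> ic_terms {1..}" for s t
    using Sc_lim_op[OF that, of "\<lambda>K. mult (Sc K)" Times]
    by (simp add: Sc_lim_def ic_eq.Times_cong ic_presentation.L_Times[OF pres])
qed (simp add: Sc_lim_term_eq_iff)

text \<open>With \<open>ic_presentation.universal_property\<close>: the direct limit is free on all the atoms
  \<open>x\<^sub>i\<close>, \<open>i \<ge> 1\<close>.\<close>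

lemma Sc_lim_ic_semiring: "ic_semiring Sc_lim"
  using Sc_lim_presentation by (rule ic_presentation.is_ic_semiring)

subsection \<open>The sets are well defined\<close>

text \<open>Truth of a term when the atom \<open>x\<^sub>i\<close> is given the binary digit of weight
  \<open>2\<^sup>i\<^sup>-\<^sup>1\<close> of \<open>k\<close>.\<close>

primrec holds :: "nat \<Rightarrow> nat ic_term \<Rightarrow> bool" where
  "holds k (Atom i) = bit k (i - 1)"
| "holds k Zero = False"
| "holds k One = True"
| "holds k (Plus s t) = (holds k s \<or> holds k t)"
| "holds k (Times s t) = (holds k s \<and> holds k t)"
| "holds k (Compl s) = (\<not> holds k s)"

lemma ic_eq_holds: "ic_eq V s t \<Longrightarrow> holds k s \<longleftrightarrow> holds k t"
  by (induction rule: ic_eq.induct) auto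

definition truth_set :: "ic_elem \<Rightarrow> nat set" where
  "truth_set \<alpha> = {k. \<exists>t\<in>\<alpha>. holds k t}"

lemma truth_set_class:
  assumes "t \<in> ic_terms V"
  shows "truth_set (ic_class V t) = {k. holds k t}"
proof -
  have "(\<exists>s. ic_eq V t s \<and> holds k s) \<longleftrightarrow> holds k t" for k
    using ic_eq.refl[OF assms] ic_eq_holds[of V t _ k] by metis
  then show ?thesis by (simp add: truth_set_def ic_class_def)
qed

abbreviation is_monomial_sum :: "nat \<Rightarrow> ic_elem \<Rightarrow> bool" where
  "is_monomial_sum N \<alpha> \<equiv> \<exists>m U. \<alpha> = monomial_sum N m U"

context
  fixes N :: nat
begin

interpretation P: ic_presentation "{1..N}" "Sc N" "ic_class {1..N}"
  by (rule ic_free_presentation)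

interpretation S: ic_semiring "Sc N"
  by (rule ic_free_ic_semiring)

lemma truth_set_Sc:
  "truth_set \<zero>\<^bsub>Sc N\<^esub> = {}" "truth_set \<one>\<^bsub>Sc N\<^esub> = UNIV"
  "a \<in> carrier (Sc N) \<Longrightarrow> b \<in> carrier (Sc N) \<Longrightarrow>
    truth_set (a \<oplus>\<^bsub>Sc N\<^esub> b) = truth_set a \<union> truth_set b"
  "a \<in> carrier (Sc N) \<Longrightarrow> b \<in> carrier (Sc N) \<Longrightarrow>
    truth_set (a \<otimes>\<^bsub>Sc N\<^esub> b) = truth_set a \<inter> truth_set b"
proof -
  show "truth_set \<zero>\<^bsub>Sc N\<^esub> = {}" "truth_set \<one>\<^bsub>Sc N\<^esub> = UNIV"
    using truth_set_class[of Zero "{1..N}"] truth_set_class[of One "{1..N}"]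
    by (simp_all add: P.L_Zero P.L_One)
next
  assume "a \<in> carrier (Sc N)" "b \<in> carrier (Sc N)"
  then obtain s t where st: "s \<in> ic_terms {1..N}" "t \<in> ic_terms {1..N}"
      "a = ic_class {1..N} s" "b = ic_class {1..N} t"
    by (auto simp: P.carrier)
  show "truth_set (a \<oplus>\<^bsub>Sc N\<^esub> b) = truth_set a \<union> truth_set b"
    using st truth_set_class[of "Plus s t" "{1..N}"] by (auto simp: P.L_Plus truth_set_class)
  show "truth_set (a \<otimes>\<^bsub>Sc N\<^esub> b) = truth_set a \<inter> truth_set b"
    using st truth_set_class[of "Times s t" "{1..N}"] by (auto simp: P.L_Times truth_set_class)
qed

lemma truth_set_finprod:
  assumes "finite J" "f \<in> J \<rightarrow> carrier (Sc N)"
  shows "truth_set (\<Otimes>\<^bsub>Sc N\<^esub>j\<in>J. f j) = (\<Inter>j\<in>J. truth_set (f j))"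
  using assms by (induction J) (auto simp: truth_set_Sc Pi_iff)

lemma truth_set_finsum:
  assumes "finite J" "f \<in> J \<rightarrow> carrier (Sc N)"
  shows "truth_set (\<Oplus>\<^bsub>Sc N\<^esub>j\<in>J. f j) = (\<Union>j\<in>J. truth_set (f j))"
  using assms by (induction J) (auto simp: truth_set_Sc Pi_iff)

lemma atom_pow_closed: "j \<in> {1..N} \<Longrightarrow> atom_pow N j e \<in> carrier (Sc N)"
  by (cases e) (auto intro: P.L_closed)

lemma truth_set_atom_pow: "j \<in> {1..N} \<Longrightarrow> truth_set (atom_pow N j e) = digit_set j e"
  by (cases e) (simp_all add: truth_set_Sc truth_set_class)

lemma monomial_closed: "monomial N u \<in> carrier (Sc N)"
  unfolding monomial_def by (intro S.finprod_closed) (auto intro: atom_pow_closed)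

lemma monomial_sum_closed: "monomial_sum N m U \<in> carrier (Sc N)"
  unfolding monomial_sum_def by (intro S.finsum_closed) (auto intro: monomial_closed)

lemma truth_set_monomial_sum: "truth_set (monomial_sum N m U) = monomial_sum_set N m U"
proof -
  have "truth_set (monomial_sum N m U) =
      (\<Union>i\<in>{1..m}. truth_set (monomial N (U i)))"
    unfolding monomial_sum_def by (rule truth_set_finsum) (auto intro: monomial_closed)
  also have "\<dots> = (\<Union>i\<in>{1..m}. \<Inter>j\<in>{1..N}. truth_set (atom_pow N j (U i j)))"
    unfolding monomial_def by (subst truth_set_finprod) (auto intro: atom_pow_closed)
  also have "\<dots> = monomial_sum_set N m U"
    by (simp add: monomial_sum_set_def truth_set_atom_pow)
  finally show ?thesis .
qed

lemma monomial_sum_set_fin_eq: "monomial_sum_set_fin N m U = aleph N \<inter> monomial_sum_set N m U"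
proof -
  have "digit_set_fin N j e = aleph N \<inter> digit_set j e" for j e by (cases e) auto
  then show ?thesis by (auto simp: monomial_sum_set_fin_def monomial_sum_set_def)
qed

lemma A_fin_monomial_sum: "A_fin N (monomial_sum N m U) = monomial_sum_set_fin N m U"
  unfolding A_fin_def
  by (rule the_equality) (auto simp: monomial_sum_set_fin_eq simp flip: truth_set_monomial_sum)

lemma A_inf_monomial_sum: "A_inf N (monomial_sum N m U) = monomial_sum_set N m U"
  unfolding A_inf_def
  by (rule the_equality) (auto simp flip: truth_set_monomial_sum)

lemma monomial_sum_0: "monomial_sum N 0 U = \<zero>\<^bsub>Sc N\<^esub>"
  by (simp add: monomial_sum_def)

lemma monomial_sum_Suc:
  "monomial_sum N (Suc m) U = monomial N (U (Suc m)) \<oplus>\<^bsub>Sc N\<^esub> monomial_sum N m U"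
  unfolding monomial_sum_def atLeastAtMostSuc_conv[of 1 m, simplified]
  by (subst S.finsum_insert) (auto intro: monomial_closed simp: atLeastAtMostSuc_conv)

lemma is_monomial_sum_mono_add:
  assumes "is_monomial_sum N a"
  shows "is_monomial_sum N (monomial N u \<oplus>\<^bsub>Sc N\<^esub> a)"
proof -
  obtain m U where a: "a = monomial_sum N m U" using assms by blast
  have "monomial_sum N m (U(Suc m := u)) = monomial_sum N m U"
    unfolding monomial_sum_def by (rule S.finsum_cong') (auto intro: monomial_closed)
  then have "monomial_sum N (Suc m) (U(Suc m := u)) = monomial N u \<oplus>\<^bsub>Sc N\<^esub> a"
    by (simp add: monomial_sum_Suc a)
  then show ?thesis by metis
qed

lemma is_monomial_sum_zero: "is_monomial_sum N \<zero>\<^bsub>Sc N\<^esub>"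
  using monomial_sum_0 by metis

lemma is_monomial_sum_mono: "is_monomial_sum N (monomial N u)"
  using is_monomial_sum_mono_add[OF is_monomial_sum_zero, of u] monomial_closed[of u] by simp

lemma is_monomial_sum_induct [consumes 1, case_names zero add]:
  assumes "is_monomial_sum N a" and "Q \<zero>\<^bsub>Sc N\<^esub>"
    and "\<And>u b. is_monomial_sum N b \<Longrightarrow> b \<in> carrier (Sc N) \<Longrightarrow> Q b \<Longrightarrow> Q (monomial N u \<oplus>\<^bsub>Sc N\<^esub> b)"
  shows "Q a"
proof -
  have "Q (monomial_sum N m U)" for m U
    by (induction m) (auto simp: monomial_sum_0 monomial_sum_Suc assms(2)
        intro!: assms(3) monomial_sum_closed)
  then show ?thesis using assms(1) by blast
qed

lemma is_monomial_sum_closed: "is_monomial_sum N a \<Longrightarrow> a \<in> carrier (Sc N)"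
  using monomial_sum_closed by blast

lemma is_monomial_sum_add:
  assumes "is_monomial_sum N a" "is_monomial_sum N b"
  shows "is_monomial_sum N (a \<oplus>\<^bsub>Sc N\<^esub> b)"
  using assms(1)
proof (induction rule: is_monomial_sum_induct)
  case zero
  then show ?case using assms(2) is_monomial_sum_closed[OF assms(2)] by simp
next
  case (add u c)
  then show ?case
    using is_monomial_sum_mono_add[OF add(3), of u] is_monomial_sum_closed[OF assms(2)] monomial_closed[of u]
    by (simp add: S.a_assoc)
qed

lemma atom_pow_mult:
  assumes j: "j \<in> {1..N}"
  shows "(\<exists>e''. atom_pow N j e \<otimes>\<^bsub>Sc N\<^esub> atom_pow N j e' = atom_pow N j e'') \<or>
    atom_pow N j e \<otimes>\<^bsub>Sc N\<^esub> atom_pow N j e' = \<zero>\<^bsub>Sc N\<^esub>"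
proof -
  have a: "Atom j \<in> ic_terms {1..N}" using j by simp
  have z: "atom_pow N j E1 \<otimes>\<^bsub>Sc N\<^esub> atom_pow N j Ec = \<zero>\<^bsub>Sc N\<^esub>"
    using P.L_laws(9)[OF a a a] by simp
  then have z': "atom_pow N j Ec \<otimes>\<^bsub>Sc N\<^esub> atom_pow N j E1 = \<zero>\<^bsub>Sc N\<^esub>"
    using S.m_comm[OF atom_pow_closed[OF j] atom_pow_closed[OF j]] by metis
  have c: "atom_pow N j e \<in> carrier (Sc N)" for e by (rule atom_pow_closed[OF j])
  consider "e = E0" | "e' = E0" | "e = e'" | "e = E1" "e' = Ec" | "e = Ec" "e' = E1"
    by (cases e; cases e') auto
  then show ?thesis
  proof cases
    case 1
    then have "atom_pow N j e \<otimes>\<^bsub>Sc N\<^esub> atom_pow N j e' = atom_pow N j e'" using c by simp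
    then show ?thesis by blast
  next
    case 2
    then have "atom_pow N j e \<otimes>\<^bsub>Sc N\<^esub> atom_pow N j e' = atom_pow N j e" using c by simp
    then show ?thesis by blast
  next
    case 3
    then show ?thesis using S.mult_idem[OF c] by metis
  qed (use z z' in metis)+
qed

lemma finprod_zero:
  assumes "finite J" "f \<in> J \<rightarrow> carrier (Sc N)" "j \<in> J" "f j = \<zero>\<^bsub>Sc N\<^esub>"
  shows "(\<Otimes>\<^bsub>Sc N\<^esub>i\<in>J. f i) = \<zero>\<^bsub>Sc N\<^esub>"
proof -
  have J: "insert j (J - {j}) = J" using assms(3) by auto
  have *: "f \<in> J - {j} \<rightarrow> carrier (Sc N)" using assms(2) by auto
  have "finprod (Sc N) f (insert j (J - {j})) = f j \<otimes>\<^bsub>Sc N\<^esub> finprod (Sc N) f (J - {j})"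
    using assms * by (intro S.finprod_insert) auto
  then show ?thesis using J assms(4) S.finprod_closed[OF *] by simp
qed

lemma is_monomial_sum_mono_mult: "is_monomial_sum N (monomial N u \<otimes>\<^bsub>Sc N\<^esub> monomial N v)"
proof -
  let ?f = "\<lambda>j. atom_pow N j (u j) \<otimes>\<^bsub>Sc N\<^esub> atom_pow N j (v j)"
  have f: "?f \<in> {1..N} \<rightarrow> carrier (Sc N)" by (intro Pi_I S.m_closed atom_pow_closed)
  have eq: "monomial N u \<otimes>\<^bsub>Sc N\<^esub> monomial N v = (\<Otimes>\<^bsub>Sc N\<^esub>j\<in>{1..N}. ?f j)"
    unfolding monomial_def by (intro S.finprod_multf[symmetric] Pi_I atom_pow_closed)
  show ?thesis
  proof (cases "\<exists>j\<in>{1..N}. ?f j = \<zero>\<^bsub>Sc N\<^esub>")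
    case True
    then have "monomial N u \<otimes>\<^bsub>Sc N\<^esub> monomial N v = \<zero>\<^bsub>Sc N\<^esub>"
      unfolding eq using finprod_zero[OF _ f] by blast
    then show ?thesis using is_monomial_sum_zero by simp
  next
    case False
    then have "\<forall>j\<in>{1..N}. \<exists>e. ?f j = atom_pow N j e" using atom_pow_mult by blast
    then obtain w where w: "\<forall>j\<in>{1..N}. ?f j = atom_pow N j (w j)" by metis
    have "(\<Otimes>\<^bsub>Sc N\<^esub>j\<in>{1..N}. ?f j) = monomial N w"
      unfolding monomial_def by (rule S.finprod_cong') (use w in \<open>auto intro: atom_pow_closed\<close>)
    then show ?thesis using is_monomial_sum_mono[of w] eq by simp
  qed
qed

lemma is_monomial_sum_mult:
  assumes "is_monomial_sum N a" "is_monomial_sum N b"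
  shows "is_monomial_sum N (a \<otimes>\<^bsub>Sc N\<^esub> b)"
proof -
  have *: "is_monomial_sum N (monomial N u \<otimes>\<^bsub>Sc N\<^esub> b)" for u
    using assms(2)
  proof (induction rule: is_monomial_sum_induct)
    case zero
    then show ?case using is_monomial_sum_zero monomial_closed[of u] by simp
  next
    case (add v c)
    then show ?case
      using is_monomial_sum_add[OF is_monomial_sum_mono_mult[of u v] add(3)] monomial_closed[of u] monomial_closed[of v]
      by (simp add: S.r_distr)
  qed
  show ?thesis
    using assms(1)
  proof (induction rule: is_monomial_sum_induct)
    case zero
    then show ?case using is_monomial_sum_zero is_monomial_sum_closed[OF assms(2)] by simp
  next
    case (add u c)
    then show ?case
      using is_monomial_sum_add[OF *[of u] add(3)] monomial_closed[of u] is_monomial_sum_closed[OF assms(2)]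
      by (simp add: S.l_distr)
  qed
qed

lemma is_monomial_sum_atom_pow:
  assumes j: "j \<in> {1..N}"
  shows "is_monomial_sum N (atom_pow N j e)"
proof -
  let ?u = "\<lambda>i. if i = j then e else E0"
  have J: "insert j ({1..N} - {j}) = {1..N}" using j by auto
  have "monomial N ?u = atom_pow N j (?u j) \<otimes>\<^bsub>Sc N\<^esub>
      (\<Otimes>\<^bsub>Sc N\<^esub>i\<in>{1..N} - {j}. atom_pow N i (?u i))"
    unfolding monomial_def by (subst J[symmetric], rule S.finprod_insert) (use j in \<open>auto intro: atom_pow_closed\<close>)
  also have "(\<Otimes>\<^bsub>Sc N\<^esub>i\<in>{1..N} - {j}. atom_pow N i (?u i)) = \<one>\<^bsub>Sc N\<^esub>"
    by (rule S.finprod_one_eqI) auto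
  finally have "monomial N ?u = atom_pow N j e" using atom_pow_closed[OF j] by simp
  then show ?thesis using is_monomial_sum_mono[of ?u] by simp
qed

lemma is_monomial_sum_one: "is_monomial_sum N \<one>\<^bsub>Sc N\<^esub>"
proof -
  have "monomial N (\<lambda>_. E0) = \<one>\<^bsub>Sc N\<^esub>"
    unfolding monomial_def by (rule S.finprod_one_eqI) auto
  then show ?thesis using is_monomial_sum_mono[of "\<lambda>_. E0"] by simp
qed

lemma class_Compl:
  assumes s: "s \<in> ic_terms {1..N}" and d: "d \<in> carrier (Sc N)"
    and "ic_class {1..N} s \<otimes>\<^bsub>Sc N\<^esub> d = \<zero>\<^bsub>Sc N\<^esub>" "ic_class {1..N} s \<oplus>\<^bsub>Sc N\<^esub> d = \<one>\<^bsub>Sc N\<^esub>"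
  shows "ic_class {1..N} (Compl s) = d"
  by (rule S.compl_unique[of "ic_class {1..N} s"])
    (use assms P.L_laws(9,10)[OF s s s] in \<open>auto intro: P.L_closed\<close>)

lemma is_monomial_sum_class:
  "t \<in> ic_terms {1..N} \<Longrightarrow>
    is_monomial_sum N (ic_class {1..N} t) \<and> is_monomial_sum N (ic_class {1..N} (Compl t))"
proof (induction t)
  case (Atom j)
  then show ?case using is_monomial_sum_atom_pow[of j E1] is_monomial_sum_atom_pow[of j Ec] by simp
next
  case Zero
  have "ic_class {1..N} (Compl Zero) = \<one>\<^bsub>Sc N\<^esub>"
    by (rule class_Compl) (simp_all add: P.L_Zero)
  then show ?case using is_monomial_sum_zero is_monomial_sum_one by (simp add: P.L_Zero)
next
  case One
  have "ic_class {1..N} (Compl One) = \<zero>\<^bsub>Sc N\<^esub>"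
    by (rule class_Compl) (simp_all add: P.L_One)
  then show ?case using is_monomial_sum_zero is_monomial_sum_one by (simp add: P.L_One)
next
  case (Compl s)
  then have s: "s \<in> ic_terms {1..N}" by simp
  have "ic_class {1..N} (Compl (Compl s)) = ic_class {1..N} s"
    by (rule class_Compl)
      (use s P.L_laws(5)[of "Compl s" s s] P.L_laws(2)[of "Compl s" s s] P.L_laws(9,10)[OF s s s]
        in \<open>auto intro: P.L_closed\<close>)
  then show ?case using Compl s by simp
next
  case (Plus s t)
  define a b a' b' where defs: "a = ic_class {1..N} s" "b = ic_class {1..N} t"
    "a' = ic_class {1..N} (Compl s)" "b' = ic_class {1..N} (Compl t)"
  have st: "s \<in> ic_terms {1..N}" "t \<in> ic_terms {1..N}" using Plus.prems by auto
  have [simp]: "a \<in> carrier (Sc N)" "b \<in> carrier (Sc N)" "a' \<in> carrier (Sc N)" "b' \<in> carrier (Sc N)"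
    using st by (auto simp: defs intro: P.L_closed)
  have l: "a \<otimes>\<^bsub>Sc N\<^esub> a' = \<zero>\<^bsub>Sc N\<^esub>" "a \<oplus>\<^bsub>Sc N\<^esub> a' = \<one>\<^bsub>Sc N\<^esub>"
    "b \<otimes>\<^bsub>Sc N\<^esub> b' = \<zero>\<^bsub>Sc N\<^esub>" "b \<oplus>\<^bsub>Sc N\<^esub> b' = \<one>\<^bsub>Sc N\<^esub>"
    using P.L_laws(9,10)[OF st(1) st(1) st(1)] P.L_laws(9,10)[OF st(2) st(2) st(2)]
    by (simp_all add: defs)
  have "ic_class {1..N} (Compl (Plus s t)) = a' \<otimes>\<^bsub>Sc N\<^esub> b'"
    using st S.de_morgan[of a b a' b'] l
    by (intro class_Compl) (auto simp: P.L_Plus simp flip: defs)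
  then show ?case
    using Plus st is_monomial_sum_add is_monomial_sum_mult by (simp add: P.L_Plus defs)
next
  case (Times s t)
  define a b a' b' where defs: "a = ic_class {1..N} s" "b = ic_class {1..N} t"
    "a' = ic_class {1..N} (Compl s)" "b' = ic_class {1..N} (Compl t)"
  have st: "s \<in> ic_terms {1..N}" "t \<in> ic_terms {1..N}" using Times.prems by auto
  have [simp]: "a \<in> carrier (Sc N)" "b \<in> carrier (Sc N)" "a' \<in> carrier (Sc N)" "b' \<in> carrier (Sc N)"
    using st by (auto simp: defs intro: P.L_closed)
  have l: "a' \<otimes>\<^bsub>Sc N\<^esub> a = \<zero>\<^bsub>Sc N\<^esub>" "a' \<oplus>\<^bsub>Sc N\<^esub> a = \<one>\<^bsub>Sc N\<^esub>"
    "b' \<otimes>\<^bsub>Sc N\<^esub> b = \<zero>\<^bsub>Sc N\<^esub>" "b' \<oplus>\<^bsub>Sc N\<^esub> b = \<one>\<^bsub>Sc N\<^esub>"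
    using P.L_laws(9,10)[OF st(1) st(1) st(1)] P.L_laws(9,10)[OF st(2) st(2) st(2)]
      S.m_comm[of a' a] S.m_comm[of b' b] S.a_comm[of a' a] S.a_comm[of b' b]
    by (simp_all add: defs[symmetric])
  have "ic_class {1..N} (Compl (Times s t)) = a' \<oplus>\<^bsub>Sc N\<^esub> b'"
    using st S.de_morgan[of a' b' a b] l S.m_comm[of "a \<otimes>\<^bsub>Sc N\<^esub> b" "a' \<oplus>\<^bsub>Sc N\<^esub> b'"]
      S.a_comm[of "a \<otimes>\<^bsub>Sc N\<^esub> b" "a' \<oplus>\<^bsub>Sc N\<^esub> b'"]
    by (intro class_Compl) (auto simp: P.L_Times simp flip: defs)
  then show ?case
    using Times st is_monomial_sum_add is_monomial_sum_mult by (simp add: P.L_Times defs)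
qed

lemma monomial_sum_ex:
  "\<alpha> \<in> carrier (Sc N) \<Longrightarrow> \<exists>m U. \<alpha> = monomial_sum N m U"
  using is_monomial_sum_class by (auto simp: P.carrier)

end

end

end

theory Submission
  imports Defs
begin

text \<open>
  Everything is read off from the truth assignments coded by the binary digits of numbers:
  \<^term>\<open>A_inf N \<alpha>\<close> is the set of assignments satisfying \<open>\<alpha>\<close>, and only its first \<open>N\<close> digits
  matter. Agreement of truth values at one assignment is a congruence on the direct limit,
  which gives soundness. Conversely, multiplication by a minterm turns every term into the minterm
  itself or into zero, and an element is determined by its products with the minterms, so
  equivalent terms are equal in the limit. If the product \<open>p\<close> of the premises entails \<open>s\<close>, then
  \<open>p \<cdot> s = p\<close>, whence \<open>s = 1 \<cdot> s \<equiv> p \<cdot> s = p \<equiv> 1\<close>.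
\<close>

section \<open>Minterms and completeness of the equational laws\<close>

text \<open>Distributing over 1 = \<open>x\<close> + \<open>x'\<close> rebuilds each side from its
  two products. This is what removes the last literal of a minterm in
  \<open>eq_by_minterms\<close>.\<close>

lemma (in ic_semiring) eq_by_cases:
  assumes [simp]: "x \<in> carrier R" "x' \<in> carrier R" "a \<in> carrier R" "b \<in> carrier R"
    and one: "x \<oplus> x' = \<one>" and eq: "x \<otimes> a = x \<otimes> b" "x' \<otimes> a = x' \<otimes> b"
  shows "a = b"
proof -
  have "a = (x \<oplus> x') \<otimes> a" by (simp add: one)
  also have "\<dots> = (x \<oplus> x') \<otimes> b" by (simp only: l_distr assms(1-4) eq)
  finally show ?thesis by (simp add: one)
qed

context
  notes One_nat_def [simp del]
begin

text \<open>Atom \<open>i\<close> reads digit \<open>i - 1\<close>, so atoms up to \<open>N\<close>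
  see only digits below \<open>N\<close>. This later permits cutting an assignment down to a member
  of \<open>aleph M\<close>.\<close>

lemma holds_cong_bits:
  assumes "t \<in> ic_terms {1..N}" and "\<And>j. j < N \<Longrightarrow> bit k j = bit k' j"
  shows "holds k t = holds k' t"
  using assms(1) by (induction t) (auto simp: assms(2))

text \<open>The normal form product y_k of the first \<open>N\<close> atoms, with \<open>k\<close>
  left unbounded so that one assignment serves every \<open>N\<close>. Digit \<open>N\<close> has
  weight 2^N and belongs to atom \<open>Suc N\<close>.\<close>

primrec minterm :: "nat \<Rightarrow> nat \<Rightarrow> nat ic_term" where
  "minterm 0 k = One"
| "minterm (Suc N) k =
     Times (minterm N k) (if bit k N then Atom (Suc N) else Compl (Atom (Suc N)))"

lemma minterm_terms: "minterm N k \<in> ic_terms {1..}"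
  by (induction N) auto

lemma minterm_cong:
  assumes "\<And>j. j < N \<Longrightarrow> bit k j = bit k' j"
  shows "minterm N k = minterm N k'"
  using assms by (induction N) auto

context
begin

interpretation P: ic_presentation "{1..}" Sc_lim Sc_lim_term
  by (rule Sc_lim_presentation)

interpretation S: ic_semiring Sc_lim
  by (rule Sc_lim_ic_semiring)

text \<open>The minterm contains a literal of atom \<open>i\<close>; by commutativity the atom meets
  that literal and is absorbed by idempotence or annihilated by its complement.\<close>

lemma minterm_mult_Atom:
  assumes "i \<in> {1..N}"
  shows "Sc_lim_term (minterm N k) \<otimes>\<^bsub>Sc_lim\<^esub> Sc_lim_term (Atom i) =
    (if bit k (i - 1) then Sc_lim_term (minterm N k) else \<zero>\<^bsub>Sc_lim\<^esub>)"
  using assms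
proof (induction N)
  case 0
  then show ?case by simp
next
  case (Suc N)
  define c where "c = Sc_lim_term (minterm N k)"
  define l where "l = (if bit k N then Atom (Suc N) else Compl (Atom (Suc N)))"
  have lt: "l \<in> ic_terms {1..}" by (simp add: l_def)
  have it: "Atom i \<in> ic_terms {1..}" using Suc.prems by simp
  define y where "y = Sc_lim_term l"
  define x where "x = Sc_lim_term (Atom i)"
  have [simp]: "c \<in> carrier Sc_lim" "y \<in> carrier Sc_lim" "x \<in> carrier Sc_lim"
    using lt it minterm_terms by (simp_all add: c_def x_def y_def P.L_closed)
  have m: "Sc_lim_term (minterm (Suc N) k) = c \<otimes>\<^bsub>Sc_lim\<^esub> y"
    using lt by (simp add: c_def y_def P.L_Times minterm_terms flip: l_def)
  show ?case
  proof (cases "i = Suc N")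
    case True
    then have "y \<otimes>\<^bsub>Sc_lim\<^esub> x = (if bit k (i - 1) then y else \<zero>\<^bsub>Sc_lim\<^esub>)"
      using P.L_laws(9,11)[OF it it it] P.L_laws(5)[OF lt it it]
      by (simp add: x_def y_def l_def)
    then show ?thesis unfolding m x_def[symmetric] by (simp add: S.m_assoc)
  next
    case False
    then have "c \<otimes>\<^bsub>Sc_lim\<^esub> x = (if bit k (i - 1) then c else \<zero>\<^bsub>Sc_lim\<^esub>)"
      using Suc by (simp add: c_def x_def)
    moreover have "c \<otimes>\<^bsub>Sc_lim\<^esub> y \<otimes>\<^bsub>Sc_lim\<^esub> x = c \<otimes>\<^bsub>Sc_lim\<^esub> x \<otimes>\<^bsub>Sc_lim\<^esub> y"
      by (simp add: S.m_ac)
    ultimately show ?thesis unfolding m x_def[symmetric] by simp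
  qed
qed

text \<open>Algebra evaluates a term: each connective acts on the products with the minterm as it
  acts on truth values. For sums where both summands hold this uses additive idempotence.\<close>

lemma minterm_mult:
  assumes "t \<in> ic_terms {1..N}"
  shows "Sc_lim_term (minterm N k) \<otimes>\<^bsub>Sc_lim\<^esub> Sc_lim_term t =
    (if holds k t then Sc_lim_term (minterm N k) else \<zero>\<^bsub>Sc_lim\<^esub>)"
proof -
  define c where "c = Sc_lim_term (minterm N k)"
  have c [simp]: "c \<in> carrier Sc_lim" by (simp add: c_def P.L_closed minterm_terms)
  have V: "t \<in> ic_terms {1..}" if "t \<in> ic_terms {1..N}" for t
    using that ic_terms_mono[of "{1..N}" "{1..}"] by auto
  have "c \<otimes>\<^bsub>Sc_lim\<^esub> Sc_lim_term t = (if holds k t then c else \<zero>\<^bsub>Sc_lim\<^esub>)"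
    using assms
  proof (induction t)
    case (Atom i)
    then show ?case using minterm_mult_Atom[of i N k] by (simp add: c_def)
  next
    case (Plus s t)
    then show ?case
      by (simp add: V P.L_Plus P.L_closed S.r_distr S.add_idem)
  next
    case (Times s t)
    then have st: "s \<in> ic_terms {1..}" "t \<in> ic_terms {1..}" using V by simp_all
    then have "c \<otimes>\<^bsub>Sc_lim\<^esub> Sc_lim_term (Times s t) =
        c \<otimes>\<^bsub>Sc_lim\<^esub> Sc_lim_term s \<otimes>\<^bsub>Sc_lim\<^esub> Sc_lim_term t"
      by (simp add: P.L_Times P.L_closed S.m_assoc)
    then show ?case using Times st by (simp add: P.L_closed)
  next
    case (Compl s)
    define a a' where "a = Sc_lim_term s" and "a' = Sc_lim_term (Compl s)"
    have s: "s \<in> ic_terms {1..}" using Compl.prems V by simp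
    have [simp]: "a \<in> carrier Sc_lim" "a' \<in> carrier Sc_lim"
      using s by (simp_all add: a_def a'_def P.L_closed)
    have laws: "a \<otimes>\<^bsub>Sc_lim\<^esub> a' = \<zero>\<^bsub>Sc_lim\<^esub>" "a \<oplus>\<^bsub>Sc_lim\<^esub> a' = \<one>\<^bsub>Sc_lim\<^esub>"
      using P.L_laws(9,10)[OF s s s] by (simp_all add: a_def a'_def)
    have IH: "c \<otimes>\<^bsub>Sc_lim\<^esub> a = (if holds k s then c else \<zero>\<^bsub>Sc_lim\<^esub>)"
      using Compl by (simp add: a_def)
    have "c \<otimes>\<^bsub>Sc_lim\<^esub> a' = (if holds k s then \<zero>\<^bsub>Sc_lim\<^esub> else c)"
    proof (cases "holds k s")
      case True
      \<comment> \<open>By \<open>IH\<close> the factor \<open>c\<close> can be replaced by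
        \<open>c\<close> times \<open>a\<close>, which brings \<open>a\<close> next to its
        complement.\<close>
      then have "c \<otimes>\<^bsub>Sc_lim\<^esub> a' = c \<otimes>\<^bsub>Sc_lim\<^esub> (a \<otimes>\<^bsub>Sc_lim\<^esub> a')"
        using IH by (simp flip: S.m_assoc)
      then show ?thesis using True laws by simp
    next
      case False
      have "c = c \<otimes>\<^bsub>Sc_lim\<^esub> (a \<oplus>\<^bsub>Sc_lim\<^esub> a')" by (simp add: laws)
      also have "\<dots> = c \<otimes>\<^bsub>Sc_lim\<^esub> a'" using False IH by (simp add: S.r_distr)
      finally show ?thesis using False by simp
    qed
    then show ?case by (simp add: a'_def)
  qed (simp_all add: P.L_Zero P.L_One)
  then show ?thesis by (simp add: c_def)
qed

text \<open>Induction downwards to the empty minterm 1: every minterm in \<open>N\<close> atoms has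
  two extensions by a literal of atom \<open>Suc N\<close>, and agreement on both gives agreement on
  the shorter one by \<open>eq_by_cases\<close>.\<close>

lemma eq_by_minterms:
  assumes "a \<in> carrier Sc_lim" "b \<in> carrier Sc_lim"
    and "\<And>k. Sc_lim_term (minterm N k) \<otimes>\<^bsub>Sc_lim\<^esub> a = Sc_lim_term (minterm N k) \<otimes>\<^bsub>Sc_lim\<^esub> b"
  shows "a = b"
  using assms(3)
proof (induction N)
  case 0
  then show ?case using assms(1,2) by (simp add: P.L_One)
next
  case (Suc N)
  have "Sc_lim_term (minterm N k) \<otimes>\<^bsub>Sc_lim\<^esub> a = Sc_lim_term (minterm N k) \<otimes>\<^bsub>Sc_lim\<^esub> b" for k
  proof -
    define c x x' where "c = Sc_lim_term (minterm N k)" and "x = Sc_lim_term (Atom (Suc N))"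
      and "x' = Sc_lim_term (Compl (Atom (Suc N)))"
    have s: "Atom (Suc N) \<in> ic_terms {1..}" by simp
    have cl [simp]: "c \<in> carrier Sc_lim" "x \<in> carrier Sc_lim" "x' \<in> carrier Sc_lim"
      using s by (simp_all add: c_def x_def x'_def P.L_closed minterm_terms)
    \<comment> \<open>Changing digit \<open>N\<close> only affects the literal of atom
      \<open>Suc N\<close>, so these two assignments yield the two extensions of the minterm of
      \<open>k\<close>.\<close>
    have "minterm N (set_bit N k) = minterm N k" "minterm N (unset_bit N k) = minterm N k"
      by (rule minterm_cong; simp add: bit_set_bit_iff bit_unset_bit_iff)+
    then have "Sc_lim_term (minterm (Suc N) (set_bit N k)) = c \<otimes>\<^bsub>Sc_lim\<^esub> x"
      "Sc_lim_term (minterm (Suc N) (unset_bit N k)) = c \<otimes>\<^bsub>Sc_lim\<^esub> x'"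
      by (simp_all add: c_def x_def x'_def P.L_Times minterm_terms bit_set_bit_iff bit_unset_bit_iff)
    then have eq: "c \<otimes>\<^bsub>Sc_lim\<^esub> x \<otimes>\<^bsub>Sc_lim\<^esub> a = c \<otimes>\<^bsub>Sc_lim\<^esub> x \<otimes>\<^bsub>Sc_lim\<^esub> b"
      "c \<otimes>\<^bsub>Sc_lim\<^esub> x' \<otimes>\<^bsub>Sc_lim\<^esub> a = c \<otimes>\<^bsub>Sc_lim\<^esub> x' \<otimes>\<^bsub>Sc_lim\<^esub> b"
      using Suc.prems[of "set_bit N k"] Suc.prems[of "unset_bit N k"] by metis+
    have "c \<otimes>\<^bsub>Sc_lim\<^esub> a = c \<otimes>\<^bsub>Sc_lim\<^esub> b"
    proof (rule S.eq_by_cases[of x x'])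
      show "x \<oplus>\<^bsub>Sc_lim\<^esub> x' = \<one>\<^bsub>Sc_lim\<^esub>"
        using P.L_laws(10)[OF s s s] by (simp add: x_def x'_def)
      show "x \<otimes>\<^bsub>Sc_lim\<^esub> (c \<otimes>\<^bsub>Sc_lim\<^esub> a) = x \<otimes>\<^bsub>Sc_lim\<^esub> (c \<otimes>\<^bsub>Sc_lim\<^esub> b)"
        "x' \<otimes>\<^bsub>Sc_lim\<^esub> (c \<otimes>\<^bsub>Sc_lim\<^esub> a) = x' \<otimes>\<^bsub>Sc_lim\<^esub> (c \<otimes>\<^bsub>Sc_lim\<^esub> b)"
        using eq assms(1,2) by (simp_all add: S.m_ac)
    qed (use assms(1,2) in auto)
    then show ?thesis by (simp add: c_def)
  qed
  then show ?case by (rule Suc.IH)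
qed

text \<open>With \<open>N\<close> large enough for both terms, their products with minterms depend
  on truth values alone, so \<open>eq_by_minterms\<close> applies.\<close>

lemma Sc_lim_term_complete:
  assumes st: "s \<in> ic_terms {1..}" "t \<in> ic_terms {1..}" and "\<And>k. holds k s = holds k t"
  shows "Sc_lim_term s = Sc_lim_term t"
proof -
  obtain N M where "s \<in> ic_terms {1..N}" "t \<in> ic_terms {1..M}"
    using st ic_terms_finite_index by meson
  then have "s \<in> ic_terms {1..max N M}" "t \<in> ic_terms {1..max N M}"
    using Sc_terms_mono[of N "max N M" s] Sc_terms_mono[of M "max N M" t] by auto
  then have "Sc_lim_term (minterm (max N M) k) \<otimes>\<^bsub>Sc_lim\<^esub> Sc_lim_term s =
      Sc_lim_term (minterm (max N M) k) \<otimes>\<^bsub>Sc_lim\<^esub> Sc_lim_term t" for k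
    by (simp add: minterm_mult assms(3))
  then show ?thesis using st P.L_closed eq_by_minterms by blast
qed

section \<open>Congruences and entailment\<close>

text \<open>This is the kernel of evaluation at \<open>k\<close>, written with representing terms;
  \<open>ic_eq_holds\<close> makes it independent of their choice.\<close>

lemma semiring_congruence_holds:
  "semiring_congruence Sc_lim {(Sc_lim_term s, Sc_lim_term t) | s t.
     s \<in> ic_terms {1..} \<and> t \<in> ic_terms {1..} \<and> (holds k s \<longleftrightarrow> holds k t)}" (is "semiring_congruence _ ?r")
proof -
  have memI: "(Sc_lim_term s, Sc_lim_term t) \<in> ?r"
    if "s \<in> ic_terms {1..}" "t \<in> ic_terms {1..}" "holds k s \<longleftrightarrow> holds k t" for s t
    using that by blast
  have eq: "holds k s \<longleftrightarrow> holds k t"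
    if "s \<in> ic_terms {1..}" "t \<in> ic_terms {1..}" "Sc_lim_term s = Sc_lim_term t" for s t
    using that P.L_eq_iff ic_eq_holds by blast
  have "equiv (carrier Sc_lim) ?r"
  proof (rule equivI)
    show "?r \<subseteq> carrier Sc_lim \<times> carrier Sc_lim" by (auto simp: P.L_closed)
    show "refl_on (carrier Sc_lim) ?r" by (rule refl_onI) (auto simp: P.carrier)
    show "sym ?r" by (rule symI) blast
    show "trans ?r"
    proof (rule transI)
      fix x y z assume "(x, y) \<in> ?r" "(y, z) \<in> ?r"
      then obtain s t t' u where "x = Sc_lim_term s" "y = Sc_lim_term t" "y = Sc_lim_term t'"
          "z = Sc_lim_term u" "s \<in> ic_terms {1..}" "t \<in> ic_terms {1..}" "t' \<in> ic_terms {1..}"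
          "u \<in> ic_terms {1..}" "holds k s \<longleftrightarrow> holds k t" "holds k t' \<longleftrightarrow> holds k u"
        by blast
      \<comment> \<open>The middle class \<open>y\<close> comes with two representatives
        \<open>t\<close> and \<open>t'\<close>, whose truth values have to be matched.\<close>
      then show "(x, z) \<in> ?r" using eq[of t t'] memI[of s u] by simp
    qed
  qed
  moreover have "(a \<oplus>\<^bsub>Sc_lim\<^esub> c, b \<oplus>\<^bsub>Sc_lim\<^esub> d) \<in> ?r \<and> (a \<otimes>\<^bsub>Sc_lim\<^esub> c, b \<otimes>\<^bsub>Sc_lim\<^esub> d) \<in> ?r"
    if ab: "(a, b) \<in> ?r" and cd: "(c, d) \<in> ?r" for a b c d
  proof -
    obtain s t where st: "a = Sc_lim_term s" "b = Sc_lim_term t"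
        "s \<in> ic_terms {1..}" "t \<in> ic_terms {1..}" "holds k s \<longleftrightarrow> holds k t"
      using ab by blast
    obtain u v where uv: "c = Sc_lim_term u" "d = Sc_lim_term v"
        "u \<in> ic_terms {1..}" "v \<in> ic_terms {1..}" "holds k u \<longleftrightarrow> holds k v"
      using cd by blast
    show ?thesis
      using memI[of "Plus s u" "Plus t v"] memI[of "Times s u" "Times t v"] st uv
      by (simp add: P.L_Plus P.L_Times)
  qed
  ultimately show ?thesis unfolding semiring_congruence_def by blast
qed

text \<open>The generated congruence is an intersection. Soundness tests it on evaluation at one
  \<open>k\<close>; the converse works inside an arbitrary congruence containing the
  generators.\<close>

lemma entails_iff_holds:
  fixes t :: "nat \<Rightarrow> nat ic_term" and n :: nat
  assumes t: "\<And>i. i \<in> {1..n} \<Longrightarrow> t i \<in> ic_terms {1..}" and s: "s \<in> ic_terms {1..}"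
  shows "(\<lambda>i. Sc_lim_term (t i)) ` {1..n} \<turnstile> Sc_lim_term s \<longleftrightarrow>
    (\<forall>k. (\<forall>i\<in>{1..n}. holds k (t i)) \<longrightarrow> holds k s)"
proof
  assume ent: "(\<lambda>i. Sc_lim_term (t i)) ` {1..n} \<turnstile> Sc_lim_term s"
  show "\<forall>k. (\<forall>i\<in>{1..n}. holds k (t i)) \<longrightarrow> holds k s"
  proof (intro allI impI)
    fix k assume k: "\<forall>i\<in>{1..n}. holds k (t i)"
    let ?r = "{(Sc_lim_term s, Sc_lim_term t) | s t.
      s \<in> ic_terms {1..} \<and> t \<in> ic_terms {1..} \<and> (holds k s \<longleftrightarrow> holds k t)}"
    have "(Sc_lim_term (t i), \<one>\<^bsub>Sc_lim\<^esub>) \<in> ?r" if i: "i \<in> {1..n}" for i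
    proof -
      have "holds k (t i) \<longleftrightarrow> holds k One" using k i by simp
      then show ?thesis unfolding P.L_One[symmetric] using t[OF i] ic_terms_simps(3) by blast
    qed
    then have "(\<lambda>\<alpha>. (\<alpha>, \<one>\<^bsub>Sc_lim\<^esub>)) ` (\<lambda>i. Sc_lim_term (t i)) ` {1..n} \<subseteq> ?r" by blast
    then have "(Sc_lim_term s, \<one>\<^bsub>Sc_lim\<^esub>) \<in> ?r"
      using ent semiring_congruence_holds[of k]
      unfolding entails_def generated_congruence_def by blast
    then obtain u v where "Sc_lim_term s = Sc_lim_term u" "Sc_lim_term One = Sc_lim_term v"
        "u \<in> ic_terms {1..}" "v \<in> ic_terms {1..}" "holds k u \<longleftrightarrow> holds k v"
      unfolding P.L_One by blast
    then have "ic_eq {1..} s u" "ic_eq {1..} One v" "holds k u \<longleftrightarrow> holds k v"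
      using s P.L_eq_iff by simp_all
    then show "holds k s" using ic_eq_holds[of "{1..}" s u k] ic_eq_holds[of "{1..}" One v k] by simp
  qed
next
  assume sem: "\<forall>k. (\<forall>i\<in>{1..n}. holds k (t i)) \<longrightarrow> holds k s"
  show "(\<lambda>i. Sc_lim_term (t i)) ` {1..n} \<turnstile> Sc_lim_term s"
    unfolding entails_def generated_congruence_def
  proof (rule InterI, clarify)
    fix r assume r: "semiring_congruence Sc_lim r"
      and gens: "(\<lambda>\<alpha>. (\<alpha>, \<one>\<^bsub>Sc_lim\<^esub>)) ` (\<lambda>i. Sc_lim_term (t i)) ` {1..n} \<subseteq> r"
    have eqv: "equiv (carrier Sc_lim) r"
      and mult: "\<And>a b c d. (a, b) \<in> r \<Longrightarrow> (c, d) \<in> r \<Longrightarrow> (a \<otimes>\<^bsub>Sc_lim\<^esub> c, b \<otimes>\<^bsub>Sc_lim\<^esub> d) \<in> r"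
      using r unfolding semiring_congruence_def by blast+
    have refl: "(a, a) \<in> r" if "a \<in> carrier Sc_lim" for a
      using eqv that by (auto simp: equiv_def refl_on_def)
    \<comment> \<open>The product of the premises is built one factor at a time, starting from
      \<open>One\<close>, which also settles the case of no premises.\<close>
    have "\<exists>p\<in>ic_terms {1..}. (\<forall>k. holds k p \<longleftrightarrow> (\<forall>i\<in>{1..m}. holds k (t i))) \<and>
        (Sc_lim_term p, \<one>\<^bsub>Sc_lim\<^esub>) \<in> r" if "m \<le> n" for m
      using that
    proof (induction m)
      case 0
      have "(Sc_lim_term One, \<one>\<^bsub>Sc_lim\<^esub>) \<in> r" by (simp add: P.L_One refl)
      then show ?case by (intro bexI[of _ One]) auto
    next
      case (Suc m)
      then obtain p where p: "p \<in> ic_terms {1..}"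
          "\<forall>k. holds k p \<longleftrightarrow> (\<forall>i\<in>{1..m}. holds k (t i))" "(Sc_lim_term p, \<one>\<^bsub>Sc_lim\<^esub>) \<in> r"
        by auto
      have i: "Suc m \<in> {1..n}" using Suc.prems by simp
      have "(Sc_lim_term (t (Suc m)), \<one>\<^bsub>Sc_lim\<^esub>) \<in> r" using gens i by blast
      then have "(Sc_lim_term (Times (t (Suc m)) p), \<one>\<^bsub>Sc_lim\<^esub>) \<in> r"
        using mult[OF _ p(3), of "Sc_lim_term (t (Suc m))" "\<one>\<^bsub>Sc_lim\<^esub>"] t[OF i] p(1)
        by (simp add: P.L_Times)
      then show ?case
        using t[OF i] p(1,2)
        by (intro bexI[of _ "Times (t (Suc m)) p"]) (auto simp: atLeastAtMostSuc_conv)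
    qed
    then obtain p where p: "p \<in> ic_terms {1..}" "\<And>k. holds k p \<longleftrightarrow> (\<forall>i\<in>{1..n}. holds k (t i))"
        "(Sc_lim_term p, \<one>\<^bsub>Sc_lim\<^esub>) \<in> r"
      by blast
    \<comment> \<open>Wherever \<open>p\<close> holds, so does \<open>s\<close>; completeness turns
      this into an equation.\<close>
    have "Sc_lim_term (Times p s) = Sc_lim_term p"
      by (rule Sc_lim_term_complete) (use p(1,2) s sem in auto)
    \<comment> \<open>Multiplying \<open>p\<close> \<equiv> 1 by \<open>s\<close> gives
      \<open>p\<close> times \<open>s\<close> \<equiv> \<open>s\<close>, and the left side is
      \<open>p\<close>.\<close>
    then have "(Sc_lim_term p, Sc_lim_term s) \<in> r"
      using mult[OF p(3) refl[OF P.L_closed[OF s]]] p(1) s by (simp add: P.L_Times P.L_closed)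
    then show "(Sc_lim_term s, \<one>\<^bsub>Sc_lim\<^esub>) \<in> r"
      using p(3) eqv by (meson equivE symD transD)
  qed
qed

end

section \<open>The attached sets as truth sets\<close>

text \<open>Replaces the definite description over sums of monomials by a set computable from any
  term representing the element.\<close>

lemma A_inf_eq_truth_set: "\<alpha> \<in> carrier (Sc N) \<Longrightarrow> A_inf N \<alpha> = truth_set \<alpha>"
  using monomial_sum_ex[of \<alpha> N] by (auto simp: A_inf_monomial_sum truth_set_monomial_sum)

lemma A_fin_eq_truth_set: "\<alpha> \<in> carrier (Sc N) \<Longrightarrow> A_fin N \<alpha> = aleph N \<inter> truth_set \<alpha>"
  using monomial_sum_ex[of \<alpha> N]
  by (auto simp: A_fin_monomial_sum truth_set_monomial_sum monomial_sum_set_fin_eq)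

lemma A_inf_class: "t \<in> ic_terms {1..N} \<Longrightarrow> A_inf N (ic_class {1..N} t) = {k. holds k t}"
  using Sc_carrier by (subst A_inf_eq_truth_set) (auto simp: truth_set_class)

text \<open>The embedding keeps the representing term, so raising the level to \<open>M\<close> only
  changes the range of assignments.\<close>

lemma A_fin_emb_class:
  assumes "t \<in> ic_terms {1..N}" "N \<le> M"
  shows "A_fin M (Sc_emb N M (ic_class {1..N} t)) = {k \<in> aleph M. holds k t}"
proof -
  have t: "t \<in> ic_terms {1..M}" using assms Sc_terms_mono by blast
  then have "A_fin M (ic_class {1..M} t) = {k \<in> aleph M. holds k t}"
    using Sc_carrier by (subst A_fin_eq_truth_set) (auto simp: truth_set_class)
  then show ?thesis using assms by (simp add: Sc_emb_class)
qed

end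

theorem theorem4p14:
  fixes n :: nat
    and \<alpha> :: "nat \<Rightarrow> ic_elem" and Ns :: "nat \<Rightarrow> nat" and \<Lambda>s :: "nat \<Rightarrow> (ic_elem \<times> nat) set"
    and \<beta> :: ic_elem and N :: nat and \<Lambda> :: "(ic_elem \<times> nat) set"
    and \<Gamma> :: "(ic_elem \<times> nat) set set"
  assumes "\<And>i. i \<in> {1..n} \<Longrightarrow> \<alpha> i \<in> carrier (Sc (Ns i))"
    and "\<And>i. i \<in> {1..n} \<Longrightarrow> \<Lambda>s i = Sc_class (\<alpha> i) (Ns i)"
    and "\<Gamma> = \<Lambda>s ` {1..n}"
    and "\<beta> \<in> carrier (Sc N)"
    and "\<Lambda> = Sc_class \<beta> N"
  shows "(\<Gamma> \<turnstile> \<Lambda> \<longleftrightarrow>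
           (\<exists>M. (\<forall>i\<in>{1..n}. Ns i \<le> M) \<and> N \<le> M \<and>
              aleph M \<inter> (\<Inter>i\<in>{1..n}. A_fin M (Sc_emb (Ns i) M (\<alpha> i)))
                \<subseteq> A_fin M (Sc_emb N M \<beta>)))
       \<and> (\<Gamma> \<turnstile> \<Lambda> \<longleftrightarrow>
           (\<Inter>i\<in>{1..n}. A_inf (Ns i) (\<alpha> i)) \<subseteq> A_inf N \<beta>)"
proof -
  note One_nat_def [simp del]
  have "\<forall>i\<in>{1..n}. \<exists>u\<in>ic_terms {1..Ns i}. \<alpha> i = ic_class {1..Ns i} u"
    using assms(1) Sc_carrier by blast
  then obtain t where t: "\<And>i. i \<in> {1..n} \<Longrightarrow> t i \<in> ic_terms {1..Ns i}"
      "\<And>i. i \<in> {1..n} \<Longrightarrow> \<alpha> i = ic_class {1..Ns i} (t i)"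
    by metis
  obtain s where s: "s \<in> ic_terms {1..N}" "\<beta> = ic_class {1..N} s"
    using assms(4) Sc_carrier by blast
  have V: "u \<in> ic_terms {1..}" if "u \<in> ic_terms {1..m}" for u and m :: nat
    using that ic_terms_mono[of "{1..m}" "{1..}"] by auto
  have \<Lambda>: "\<Lambda> = Sc_lim_term s" using assms(5) s by (simp add: Sc_class_term)
  have \<Gamma>: "\<Gamma> = (\<lambda>i. Sc_lim_term (t i)) ` {1..n}"
    unfolding assms(3) by (rule image_cong) (use assms(2) t in \<open>auto simp: Sc_class_term\<close>)
  \<comment> \<open>Semantic consequence, to which all three conditions are reduced.\<close>
  let ?sem = "\<forall>k. (\<forall>i\<in>{1..n}. holds k (t i)) \<longrightarrow> holds k s"
  have ent: "\<Gamma> \<turnstile> \<Lambda> \<longleftrightarrow> ?sem"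
    unfolding \<Gamma> \<Lambda> by (rule entails_iff_holds) (use V t(1) s(1) in auto)
  have inf: "(\<Inter>i\<in>{1..n}. A_inf (Ns i) (\<alpha> i)) \<subseteq> A_inf N \<beta> \<longleftrightarrow> ?sem"
    using t s by (auto simp: A_inf_class)
  \<comment> \<open>The equivalence holds for every admissible \<open>M\<close>, so the choice of
    \<open>M\<close> is immaterial. Intersecting with \<open>aleph M\<close> matters for
    \<open>n = 0\<close>, where the indexed intersection is \<open>UNIV\<close>.\<close>
  have fin: "aleph M \<inter> (\<Inter>i\<in>{1..n}. A_fin M (Sc_emb (Ns i) M (\<alpha> i))) \<subseteq> A_fin M (Sc_emb N M \<beta>)
      \<longleftrightarrow> ?sem" if M: "\<forall>i\<in>{1..n}. Ns i \<le> M" "N \<le> M" for M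
  proof -
    have "aleph M \<inter> (\<Inter>i\<in>{1..n}. A_fin M (Sc_emb (Ns i) M (\<alpha> i))) \<subseteq> A_fin M (Sc_emb N M \<beta>) \<longleftrightarrow>
        (\<forall>k\<in>aleph M. (\<forall>i\<in>{1..n}. holds k (t i)) \<longrightarrow> holds k s)"
      using t s M by (auto simp: A_fin_emb_class)
    also have "\<dots> \<longleftrightarrow> ?sem"
    proof (intro iffI allI impI)
      fix k
      assume *: "\<forall>k\<in>aleph M. (\<forall>i\<in>{1..n}. holds k (t i)) \<longrightarrow> holds k s"
        and k: "\<forall>i\<in>{1..n}. holds k (t i)"
      \<comment> \<open>An arbitrary assignment is replaced by its first \<open>M\<close> digits, a
        number below 2^M with the same truth values on the terms at hand.\<close>
      have trunc: "holds (take_bit M k) u = holds k u" if "u \<in> ic_terms {1..M}" for u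
        by (rule holds_cong_bits[OF that]) (simp add: bit_take_bit_iff)
      have "take_bit M k \<in> aleph M" by (simp add: aleph_def)
      moreover have "\<forall>i\<in>{1..n}. t i \<in> ic_terms {1..M}" "s \<in> ic_terms {1..M}"
        using t(1) s(1) M Sc_terms_mono by blast+
      ultimately show "holds k s" using * k trunc by auto
    qed auto
    finally show ?thesis .
  qed
  \<comment> \<open>Some admissible \<open>M\<close> must exist for \<open>?sem\<close> to yield the
    existential condition.\<close>
  have "finite (insert N (Ns ` {1..n}))" by simp
  then obtain M where "\<forall>i\<in>{1..n}. Ns i \<le> M" "N \<le> M"
    unfolding finite_nat_set_iff_bounded_le by auto
  then have "(\<exists>M. (\<forall>i\<in>{1..n}. Ns i \<le> M) \<and> N \<le> M \<and>
      aleph M \<inter> (\<Inter>i\<in>{1..n}. A_fin M (Sc_emb (Ns i) M (\<alpha> i))) \<subseteq> A_fin M (Sc_emb N M \<beta>))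
      \<longleftrightarrow> ?sem"
    using fin by meson
  then show ?thesis unfolding ent inf by (rule conjI[OF HOL.sym HOL.refl])
qed

end
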